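(* Let $\epsilon$ be a unit of $\mathcal{O}_{\wp}$ with $\mathbf{Norm}_{\mathbb{K}_{\wp}/\mathbf{k}}(\epsilon) = 1$. Then there exist an integer $\ell$ with $0 \le \ell \le q^{\mathbf{deg}(\wp)} - 2$ and a polynomial $\mathcal{Q}(x) \in \mathbf{A}[x]$ of degree at most $q^{\mathbf{deg}(\wp)} - 2$ such that $\mathcal{Q}(\lambda_{\wp})$ is a unit in $\mathcal{O}_{\wp}$ and the following hold: (R1) $\displaystyle \epsilon = \left(\frac{\lambda_{\wp}}{C_{\mathfrak{g}}(\lambda_{\wp})}\right)^{\ell}\frac{\mathcal{Q}(\lambda_{\wp})}{\mathcal{Q}(C_{\mathfrak{g}}(\lambda_{\wp}))}$. (R2) This representation is unique up to replacing $\mathcal{Q}$ by $\upsilon\mathcal{Q}$ with $\upsilon \in \mathbb{F}_q^{\times}$: if $\ell_{\star}$ is an integer with $0 \le \ell_{\star} \le q^{\mathbf{deg}(\wp)} - 2$ and $\mathcal{Q}_{\star}(x) \in \mathbf{A}[x]$ has degree at most $q^{\mathbf{deg}(\wp)} - 2$ with $\mathcal{Q}_{\star}(\lambda_{\wp})$ a unit in $\mathcal{O}_{\wp}$ and $\epsilon = \left(\frac{\lambda_{\wp}}{C_{\mathfrak{g}}(\lambda_{\wp})}\right)^{\ell_{\star}}\frac{\mathcal{Q}_{\star}(\lambda_{\wp})}{\mathcal{Q}_{\star}(C_{\mathfrak{g}}(\lambda_{\wp}))}$, then $\ell_{\star} = \ell$ and $\mathcal{Q}_{\star}(x) = \upsilon\mathcal{Q}(x)$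 for some $\upsilon \in \mathbb{F}_q^{\times}$.
   Context: Let $q$ be a power of a prime $p$, $\mathbf{A} = \mathbb{F}_q[T]$, $\mathbf{k} = \mathbb{F}_q(T)$, with algebraic closure $\mathbf{k}^{\mathrm{alg}}$. Let $C$ be the Carlitz module, i.e. the $\mathbb{F}_q$-algebra homomorphism $a \mapsto C_a$ from $\mathbf{A}$ to the twisted polynomial ring $\mathbf{k}\langle\tau\rangle$ ($\tau(x)=x^q$) determined by $C_T = T + \tau$; for $a \in \mathbf{A}$, $C_a(x)$ is then an $\mathbb{F}_q$-linear polynomial in $\mathbf{A}[x]$. Fix a monic irreducible $\wp \in \mathbf{A}$ of positive degree, and assume $q > 2$ or $\mathbf{deg}(\wp) > 1$. Let $\lambda_{\wp}$ be a generator of the $\mathbf{A}$-module $\{\lambda \in \mathbf{k}^{\mathrm{alg}} : C_{\wp}(\lambda) = 0\}$, let $\mathbb{K}_{\wp} = \mathbf{k}(\lambda_{\wp})$ (a Galois extension of $\mathbf{k}$ of degree $q^{\mathbf{deg}(\wp)}-1$), and let $\mathcal{O}_{\wp}$ be the integral closure of $\mathbf{A}$ in $\mathbb{K}_{\wp}$. Fix $\mathfrak{g} \in \mathbf{A}$ whose class generates the cyclic group $(\mathbf{A}/\wp\mathbf{A})^{\times}$, and let $\sigma_{\mathfrak{g}} \in \mathrm{Gal}(\mathbb{K}_{\wp}/\mathbf{k})$ be the automorphism with $\sigma_{\mathfrak{g}}(\lambda_{\wp}) = C_{\mathfrak{g}}(\lambda_{\wp})$. *)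

theory Defs
  imports
    "HOL-Algebra.Algebraic_Closure_Type"
    "HOL-Number_Theory.Cong"
    "HOL-Library.Cardinality"
    "HOL-Library.FuncSet"
begin

text \<open>
  A finite field with \<open>q\<close> elements is a type \<open>'a :: {finite, field}\<close> with \<open>q = CARD('a)\<close>; \<open>A\<close> is
  \<open>'a poly\<close>, its fraction field \<open>k\<close> is \<open>'a poly fract\<close>, and the algebraic closure of \<open>k\<close> is
  \<open>'a poly fract alg_closure\<close>.  Polynomials in \<open>A[x]\<close> have type \<open>'a poly poly\<close>: the inner
  variable is \<open>T\<close>, the outer one is \<open>x\<close>.
\<close>

definition poly_to_ac :: "'a::field poly \<Rightarrow> 'a poly fract alg_closure" where
  "poly_to_ac a = to_ac (to_fract a)"

abbreviation poly_at :: "'a::field poly poly \<Rightarrow> 'a poly fract alg_closure \<Rightarrow> 'a poly fract alg_closure" where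
  "poly_at Q x \<equiv> poly (map_poly poly_to_ac Q) x"

subsection \<open>Twisted polynomials and the Carlitz module\<close>

text \<open>
  The twisted polynomial \<open>\<Sum>i. c\<^sub>i \<tau>\<^sup>i\<close> is stored as the polynomial with coefficients \<open>c\<^sub>i\<close>.
  Addition is the usual one; multiplication is determined by \<open>\<tau> c = c\<^sup>q \<tau>\<close>, so that
  \<open>c \<tau>\<^sup>i (\<Sum>j. d\<^sub>j \<tau>\<^sup>j) = c (\<Sum>j. d\<^sub>j^(q^i) \<tau>\<^sup>j) \<tau>\<^sup>i\<close>.
\<close>

definition twisted_mult :: "nat \<Rightarrow> 'k::field poly \<Rightarrow> 'k poly \<Rightarrow> 'k poly" where
  "twisted_mult q f g =
     (\<Sum>i\<le>degree f. smult (coeff f i) (map_poly (\<lambda>c. c ^ (q ^ i)) g * monom 1 i))"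

definition twisted_power :: "nat \<Rightarrow> 'k::field poly \<Rightarrow> nat \<Rightarrow> 'k poly" where
  "twisted_power q f n = (twisted_mult q f ^^ n) 1"

definition carlitz_T :: "'a::{finite,field} poly fract poly" where
  "carlitz_T = [:to_fract [:0, 1:], 1:]"

text \<open>
  The image of \<open>a = \<Sum>i. a\<^sub>i T\<^sup>i\<close> under an \<open>F\<^sub>q\<close>-algebra homomorphism sending \<open>T\<close> to \<open>T + \<tau>\<close> is
  necessarily \<open>\<Sum>i. a\<^sub>i (T + \<tau>)\<^sup>i\<close>.  Lemmas \<open>carlitz_hom\<close> and \<open>carlitz_unique\<close> below verify that this
  is indeed the unique such homomorphism.
\<close>

definition carlitz :: "'a::{finite,field} poly \<Rightarrow> 'a poly fract poly" where
  "carlitz a =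
     (\<Sum>i\<le>degree a. smult (to_fract [:coeff a i:]) (twisted_power CARD('a) carlitz_T i))"

text \<open>The value \<open>C\<^sub>a(x)\<close>, where \<open>\<tau>\<close> acts as \<open>x \<mapsto> x\<^sup>q\<close>.\<close>

definition carlitz_eval ::
    "'a::{finite,field} poly \<Rightarrow> 'a poly fract alg_closure \<Rightarrow> 'a poly fract alg_closure" where
  "carlitz_eval a x = (\<Sum>i\<le>degree (carlitz a). to_ac (coeff (carlitz a) i) * x ^ (CARD('a) ^ i))"

definition carlitz_torsion :: "'a::{finite,field} poly \<Rightarrow> 'a poly fract alg_closure set" where
  "carlitz_torsion a = {x. carlitz_eval a x = 0}"

definition is_carlitz_generator ::
    "'a::{finite,field} poly \<Rightarrow> 'a poly fract alg_closure \<Rightarrow> bool" where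
  "is_carlitz_generator a l \<longleftrightarrow>
     l \<in> carlitz_torsion a \<and> (\<forall>x\<in>carlitz_torsion a. \<exists>b. x = carlitz_eval b l)"

subsection \<open>Field extensions, norms and integral closure\<close>

definition is_subfield :: "'k::field set \<Rightarrow> bool" where
  "is_subfield F \<longleftrightarrow> 1 \<in> F \<and> (\<forall>x\<in>F. \<forall>y\<in>F. x - y \<in> F \<and> x * y \<in> F) \<and> (\<forall>x\<in>F. inverse x \<in> F)"

definition adjoin :: "'k::field set \<Rightarrow> 'k \<Rightarrow> 'k set" where
  "adjoin F x = is_subfield hull (insert x F)"

definition base_field :: "'a::field poly fract alg_closure set" where
  "base_field = range to_ac"

text \<open>Restricting to extensional functions makes an automorphism of \<open>K\<close> a unique HOL function.\<close>

definition galois_group :: "'k::field set \<Rightarrow> 'k set \<Rightarrow> ('k \<Rightarrow> 'k) set" where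
  "galois_group K F = {\<sigma> \<in> extensional K. bij_betw \<sigma> K K \<and>
     (\<forall>x\<in>K. \<forall>y\<in>K. \<sigma> (x + y) = \<sigma> x + \<sigma> y \<and> \<sigma> (x * y) = \<sigma> x * \<sigma> y) \<and> (\<forall>x\<in>F. \<sigma> x = x)}"

text \<open>
  The norm of a finite Galois extension \<open>K/F\<close>.  Lemma \<open>finite_galois_group\<close> below
  shows that the product is over a finite set in the case of interest.
\<close>

definition galois_norm :: "'k::field set \<Rightarrow> 'k set \<Rightarrow> 'k \<Rightarrow> 'k" where
  "galois_norm K F x = (\<Prod>\<sigma>\<in>galois_group K F. \<sigma> x)"

definition integral_closure ::
    "'a::field poly fract alg_closure set \<Rightarrow> 'a poly fract alg_closure set" where
  "integral_closure K = {x \<in> K. \<exists>p :: 'a poly poly. lead_coeff p = 1 \<and> poly_at p x = 0}"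

definition units_in :: "'k::field set \<Rightarrow> 'k set" where
  "units_in R = {u \<in> R. \<exists>v\<in>R. u * v = 1}"

text \<open>\<open>K = k(\<lambda>)\<close> and the integral closure of \<open>A\<close> in it.\<close>

definition carlitz_field :: "'a::field poly fract alg_closure \<Rightarrow> 'a poly fract alg_closure set" where
  "carlitz_field l = adjoin base_field l"

definition carlitz_integers :: "'a::field poly fract alg_closure \<Rightarrow> 'a poly fract alg_closure set" where
  "carlitz_integers l = integral_closure (carlitz_field l)"

text \<open>The class of \<open>g\<close> generates the unit group of \<open>A/mA\<close>.\<close>

definition generates_units_mod :: "'a::field poly \<Rightarrow> 'a poly \<Rightarrow> bool" where
  "generates_units_mod m g \<longleftrightarrow>
     coprime g m \<and> (\<forall>a. coprime a m \<longrightarrow> (\<exists>n::nat. [a = g ^ n] (mod m)))"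

subsection \<open>Sanity checks\<close>

lemma twisted_mult_bound:
  assumes "degree f \<le> n" "q > 0"
  shows "twisted_mult q f g =
     (\<Sum>i\<le>n. smult (coeff f i) (map_poly (\<lambda>c. c ^ (q ^ i)) g * monom 1 i))"
  unfolding twisted_mult_def
  by (rule sum.mono_neutral_left) (use assms in \<open>auto simp: coeff_eq_0\<close>)

lemma twisted_mult_add_left:
  assumes "q > 0"
  shows "twisted_mult q (f + f') g = twisted_mult q f g + twisted_mult q f' g"
proof -
  define n where "n = max (degree f) (degree f')"
  have "degree f \<le> n" "degree f' \<le> n" "degree (f + f') \<le> n"
    by (auto simp: n_def degree_add_le_max)
  thus ?thesis using assms
    by (simp add: twisted_mult_bound[of _ n] smult_add_left sum.distrib)
qed

lemma carlitz_bound: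
  fixes a :: "'a::{finite,field} poly"
  assumes "degree a \<le> n"
  shows "carlitz a = (\<Sum>i\<le>n. smult (to_fract [:coeff a i:]) (twisted_power CARD('a) carlitz_T i))"
  unfolding carlitz_def
  by (rule sum.mono_neutral_left) (use assms in \<open>auto simp: coeff_eq_0\<close>)

lemma finite_field_power_card:
  fixes c :: "'a::{finite,field}"
  shows "c ^ CARD('a) = c"
proof (cases "c = 0")
  case False
  have b: "bij_betw (\<lambda>x. c * x) (UNIV - {0}) (UNIV - {0})"
    by (rule bij_betwI[of _ _ _ "\<lambda>x. x / c"]) (use False in auto)
  have "(\<Prod>x\<in>UNIV - {0}. x) = (\<Prod>x\<in>UNIV - {0}. c * x)"
    using prod.reindex_bij_betw[OF b, of "\<lambda>x. x"] by simp
  also have "\<dots> = c ^ (CARD('a) - 1) * (\<Prod>x\<in>UNIV - {0}. x)"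
    by (simp add: prod.distrib card_Diff_singleton)
  finally have "c ^ (CARD('a) - 1) = 1" by simp
  moreover have "CARD('a) = Suc (CARD('a) - 1)"
    using zero_less_card_finite[where 'a='a] by linarith
  ultimately show ?thesis by (metis power_Suc mult_1_right)
qed (simp add: zero_power)


lemma card_field_ge_2: "CARD('a::{finite,field}) \<ge> 2"
proof -
  have "card {0, 1 :: 'a} \<le> CARD('a)"
    by (rule card_mono) auto
  thus ?thesis by simp
qed

lemma poly_eq_0_if_many_roots:
  fixes p :: "'k::idom poly" and \<kappa> :: "'a::finite \<Rightarrow> 'k"
  assumes "inj \<kappa>" "\<And>c. poly p (\<kappa> c) = 0" "degree p < CARD('a)"
  shows "p = 0"
proof (rule ccontr)
  assume "p \<noteq> 0"
  have "CARD('a) = card (range \<kappa>)"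
    using assms(1) by (simp add: card_image)
  also have "\<dots> \<le> card {x. poly p x = 0}"
    by (rule card_mono) (use assms \<open>p \<noteq> 0\<close> in \<open>auto simp: poly_roots_finite\<close>)
  also have "\<dots> \<le> degree p"
    using \<open>p \<noteq> 0\<close> by (rule card_poly_roots_bound)
  finally show False using assms(3) by simp
qed

lemma degree_diff_less_if_monic:
  fixes f g :: "'k::idom poly"
  assumes "degree f = n" "degree g = n" "lead_coeff f = 1" "lead_coeff g = 1" "n > 0"
  shows "degree (f - g) < n"
proof -
  have "degree (f - g) \<le> n" using assms by (simp add: degree_diff_le)
  moreover have "coeff (f - g) n = 0" using assms by simp
  ultimately show ?thesis
    using assms(5) by (metis coeff_0 degree_0 le_neq_implies_less leading_coeff_0_iff)
qed

text \<open>
  If a field \<open>L\<close> contains \<open>F\<^sub>q\<close> (via \<open>\<kappa>\<close>), then \<open>x \<mapsto> x\<^sup>q\<close> is additive on \<open>L\<close>.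
\<close>

lemma frobenius_add:
  fixes \<kappa> :: "'a::{finite,field} \<Rightarrow> 'k::field" and x y :: 'k
  assumes inj: "inj \<kappa>" and diff: "\<And>a b. \<kappa> (a - b) = \<kappa> a - \<kappa> b"
    and pow: "\<And>c. \<kappa> c ^ CARD('a) = \<kappa> c"
  shows "(x + y) ^ CARD('a) = x ^ CARD('a) + y ^ CARD('a)"
proof -
  define q where "q = CARD('a)"
  have q: "q \<ge> 2" using card_field_ge_2[where 'a='a] by (simp add: q_def)
  have factor: "z ^ q - z = (\<Prod>c\<in>UNIV. z - \<kappa> c)" for z
  proof -
    define f where "f = monom 1 q + [:0, -1 :: 'k:]"
    define g where "g = (\<Prod>c\<in>UNIV. [:- \<kappa> c, 1:])"
    have df: "degree f = q"
      unfolding f_def using q by (subst degree_add_eq_left) (auto simp: degree_monom_eq)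
    have lf: "lead_coeff f = 1"
      unfolding df using q by (auto simp: f_def coeff_pCons split: nat.splits)
    have dg: "degree g = q"
      unfolding g_def by (subst degree_prod_eq_sum_degree) (auto simp: q_def)
    have lg: "lead_coeff g = 1"
      unfolding g_def lead_coeff_prod by simp
    have "degree (f - g) < q"
      by (rule degree_diff_less_if_monic) (use df lf dg lg q in auto)
    moreover have "poly (f - g) (\<kappa> c) = 0" for c
    proof -
      have "poly g (\<kappa> c) = 0" unfolding g_def poly_prod
        by (rule prod_zero) auto
      thus ?thesis using pow by (simp add: f_def poly_monom q_def)
    qed
    ultimately have "f - g = 0"
      using poly_eq_0_if_many_roots[OF inj] unfolding q_def by blast
    hence "poly f z = poly g z" by simp
    thus ?thesis by (simp add: f_def g_def poly_monom poly_prod)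
  qed
  have shift: "(z + \<kappa> c) ^ q = z ^ q + \<kappa> c" for z c
  proof -
    have "(z + \<kappa> c) ^ q - (z + \<kappa> c) = (\<Prod>c'\<in>UNIV. z - \<kappa> (c' - c))"
      unfolding factor by (rule prod.cong) (auto simp: diff)
    also have "\<dots> = (\<Prod>c'\<in>UNIV. z - \<kappa> c')"
      by (rule prod.reindex_bij_betw[of "\<lambda>c'. c' - c" UNIV UNIV "\<lambda>c'. z - \<kappa> c'"])
         (rule bij_betwI[of _ _ _ "\<lambda>c'. c' + c"], auto)
    also have "\<dots> = z ^ q - z" by (simp add: factor)
    finally show ?thesis by (simp add: algebra_simps)
  qed
  define G where "G = [:y, 1:] ^ q - monom 1 q"
  have "degree G < q"
    unfolding G_def
    by (rule degree_diff_less_if_monic)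
       (use q in \<open>auto simp: degree_linear_power degree_monom_eq coeff_linear_power\<close>)
  hence "degree (G - [:y ^ q:]) < CARD('a)"
    using q unfolding q_def
    by (intro le_less_trans[OF degree_diff_le_max]) auto
  moreover have "poly (G - [:y ^ q:]) (\<kappa> c) = 0" for c
    using shift[of y c] pow[of c] by (simp add: G_def poly_monom q_def)
  ultimately have "G - [:y ^ q:] = 0"
    using poly_eq_0_if_many_roots[OF inj] by blast
  hence "poly (G - [:y ^ q:]) x = 0" by simp
  thus ?thesis by (simp add: G_def poly_monom q_def algebra_simps)
qed

lemma to_fract_const:
  fixes a b c :: "'a::{finite,field}"
  shows "inj (\<lambda>c::'a. to_fract [:c:])"
    and "to_fract [:a - b:] = to_fract [:a:] - to_fract [:b:]"
    and "to_fract [:c:] ^ CARD('a) = to_fract [:c:]"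
proof -
  have pow: "to_fract x ^ n = to_fract (x ^ n)" for x :: "'a poly" and n
    by (induction n) auto
  have "[:c:] ^ n = [:c ^ n:]" for n
    by (induction n) auto
  thus "to_fract [:c:] ^ CARD('a) = to_fract [:c:]"
    by (simp add: pow finite_field_power_card)
  show "to_fract [:a - b:] = to_fract [:a:] - to_fract [:b:]"
    by (simp flip: to_fract_diff)
qed (auto simp: inj_def)

lemma frobenius_add_fract:
  fixes x y :: "'a::{finite,field} poly fract"
  shows "(x + y) ^ CARD('a) = x ^ CARD('a) + y ^ CARD('a)"
  by (rule frobenius_add[of "\<lambda>c. to_fract [:c:]"]) (rule to_fract_const)+

lemma frobenius_iter_add:
  fixes x y :: "'k::field"
  assumes "\<And>x y :: 'k. (x + y) ^ q = x ^ q + y ^ q"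
  shows "(x + y) ^ (q ^ i) = x ^ (q ^ i) + y ^ (q ^ i)"
  by (induction i) (simp_all add: power_mult assms mult.commute[of q])

lemma smult_sum_right: "smult c (sum f A) = (\<Sum>i\<in>A. smult c (f i))"
  by (induction A rule: infinite_finite_induct) (simp_all add: smult_add_right)

lemma twisted_mult_sum_left:
  "q > 0 \<Longrightarrow> twisted_mult q (sum f A) g = (\<Sum>i\<in>A. twisted_mult q (f i) g)"
  by (induction A rule: infinite_finite_induct)
     (simp_all add: twisted_mult_add_left, simp_all add: twisted_mult_def)

lemma map_poly_add_hom:
  assumes "h 0 = 0" "\<And>x y. h (x + y) = h x + h y"
  shows "map_poly h (f + g) = map_poly h f + map_poly h g"
  by (rule poly_eqI) (simp add: coeff_map_poly assms)

lemma twisted_mult_add_right: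
  fixes f g g' :: "'k::field poly"
  assumes "\<And>x y :: 'k. (x + y) ^ q = x ^ q + y ^ q" "q > 0"
  shows "twisted_mult q f (g + g') = twisted_mult q f g + twisted_mult q f g'"
  unfolding twisted_mult_def
  by (subst map_poly_add_hom)
     (use assms in \<open>auto simp: frobenius_iter_add algebra_simps smult_add_right sum.distrib zero_power\<close>)

lemma twisted_mult_sum_right:
  fixes f :: "'k::field poly"
  assumes "\<And>x y :: 'k. (x + y) ^ q = x ^ q + y ^ q" "q > 0"
  shows "twisted_mult q f (sum g A) = (\<Sum>i\<in>A. twisted_mult q f (g i))"
  by (induction A rule: infinite_finite_induct)
     (auto simp: twisted_mult_add_right assms, auto simp: twisted_mult_def)

lemma twisted_mult_monom:
  assumes "q > 0"
  shows "twisted_mult q (monom a i) (monom b j) = monom (a * b ^ (q ^ i)) (i + j)"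
proof -
  have "twisted_mult q (monom a i) (monom b j) =
      (\<Sum>l\<le>i. smult (coeff (monom a i) l) (map_poly (\<lambda>c. c ^ (q ^ l)) (monom b j) * monom 1 l))"
    by (rule twisted_mult_bound) (use assms in \<open>auto simp: degree_monom_le\<close>)
  also have "\<dots> = (\<Sum>l\<in>{i}. smult (coeff (monom a i) l) (map_poly (\<lambda>c. c ^ (q ^ l)) (monom b j) * monom 1 l))"
    by (rule sum.mono_neutral_right) auto
  also have "\<dots> = monom (a * b ^ (q ^ i)) (i + j)"
    using assms by (simp add: map_poly_monom mult_monom smult_monom add.commute zero_power)
  finally show ?thesis .
qed

lemma twisted_mult_assoc:
  fixes f g h :: "'k::field poly"
  assumes fr: "\<And>x y :: 'k. (x + y) ^ q = x ^ q + y ^ q" and q: "q > 0"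
  shows "twisted_mult q (twisted_mult q f g) h = twisted_mult q f (twisted_mult q g h)"
proof -
  have 1: "twisted_mult q (twisted_mult q (monom a i) (monom b j)) (monom c l) =
     twisted_mult q (monom a i) (twisted_mult q (monom b j) (monom c l))" for a b c :: 'k and i j l
    using q by (simp add: twisted_mult_monom power_mult_distrib power_add mult.assoc add.assoc
      mult.commute[of "q ^ i"] flip: power_mult)
  have sum_left: "twisted_mult q (sum f A) g = (\<Sum>i\<in>A. twisted_mult q (f i) g)"
    for f :: "nat \<Rightarrow> 'k poly" and g A
    using q by (rule twisted_mult_sum_left)
  have sum_right: "twisted_mult q f (sum g A) = (\<Sum>i\<in>A. twisted_mult q f (g i))"
    for A and f :: "'k poly" and g :: "nat \<Rightarrow> 'k poly"
    using fr q by (rule twisted_mult_sum_right)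
  have 2: "twisted_mult q (twisted_mult q (\<Sum>i\<in>A. monom (a i) i) (\<Sum>j\<in>B. monom (b j) j)) (\<Sum>l\<in>D. monom (c l) l) =
     twisted_mult q (\<Sum>i\<in>A. monom (a i) i) (twisted_mult q (\<Sum>j\<in>B. monom (b j) j) (\<Sum>l\<in>D. monom (c l) l))"
    for A B D and a b c :: "nat \<Rightarrow> 'k"
    by (simp add: sum_left sum_right 1)
  show ?thesis
    using 2[of "coeff f" "{..degree f}" "coeff g" "{..degree g}" "coeff h" "{..degree h}"]
    by (simp add: poly_as_sum_of_monoms)
qed

lemma twisted_mult_const_left:
  "twisted_mult q [:c:] f = smult c f"
  by (simp add: twisted_mult_def map_poly_idI)

lemma twisted_mult_1 [simp]:
  "q > 0 \<Longrightarrow> twisted_mult q 1 f = f" "q > 0 \<Longrightarrow> twisted_mult q f 1 = f"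
proof -
  show "twisted_mult q 1 f = f" using twisted_mult_const_left[of q 1 f] by (simp flip: one_pCons)
  show "twisted_mult q f 1 = f" if "q > 0"
    by (simp add: twisted_mult_def poly_as_sum_of_monoms smult_monom)
qed


lemma twisted_mult_smult_left:
  assumes "q > 0"
  shows "twisted_mult q (smult c f) g = smult c (twisted_mult q f g)"
  using twisted_mult_bound[OF degree_smult_le assms]
  by (simp add: twisted_mult_def smult_sum_right)

lemma twisted_mult_smult_right:
  assumes "c ^ q = c" "q > 0"
  shows "twisted_mult q f (smult c g) = smult c (twisted_mult q f g)"
proof -
  have "c ^ (q ^ i) = c" for i
    by (induction i) (simp_all add: power_mult assms)
  hence "map_poly (\<lambda>x. x ^ (q ^ i)) (smult c g) = smult c (map_poly (\<lambda>x. x ^ (q ^ i)) g)" for i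
    using assms by (intro poly_eqI) (simp add: coeff_map_poly power_mult_distrib zero_power)
  thus ?thesis
    by (simp add: twisted_mult_def smult_sum_right mult.commute)
qed

lemma carlitz_pCons:
  fixes a :: "'a::{finite,field} poly"
  shows "carlitz (pCons c a) = [:to_fract [:c:]:] + twisted_mult CARD('a) carlitz_T (carlitz a)"
proof -
  define q where "q = CARD('a)"
  have q: "q > 0" by (simp add: q_def)
  have sum_right: "twisted_mult q f (sum g A) = (\<Sum>i\<in>A. twisted_mult q f (g i))"
    for A and f :: "'a poly fract poly" and g :: "nat \<Rightarrow> 'a poly fract poly"
    unfolding q_def by (rule twisted_mult_sum_right) (simp_all add: frobenius_add_fract)
  have "carlitz (pCons c a) =
      (\<Sum>i\<le>Suc (degree a). smult (to_fract [:coeff (pCons c a) i:]) (twisted_power q carlitz_T i))"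
    unfolding q_def by (rule carlitz_bound) (simp add: degree_pCons_le)
  also have "\<dots> = [:to_fract [:c:]:] + (\<Sum>i\<le>degree a.
      smult (to_fract [:coeff a i:]) (twisted_mult q carlitz_T (twisted_power q carlitz_T i)))"
    by (subst sum.atMost_Suc_shift) (simp add: twisted_power_def smult_one)
  also have "\<dots> = [:to_fract [:c:]:] + twisted_mult q carlitz_T (carlitz a)"
    by (simp add: carlitz_def sum_right twisted_mult_smult_right to_fract_const(3) flip: q_def)
       (simp add: q_def twisted_mult_smult_right to_fract_const(3))
  finally show ?thesis by (simp add: q_def)
qed

theorem carlitz_hom:
  fixes a b :: "'a::{finite,field} poly" and c :: 'a
  shows "carlitz (a + b) = carlitz a + carlitz b"
    and "carlitz (a * b) = twisted_mult CARD('a) (carlitz a) (carlitz b)"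
    and "carlitz [:c:] = [:to_fract [:c:]:]"
    and "carlitz [:0, 1 :: 'a:] = carlitz_T"
proof -
  have carlitz_0: "carlitz (0 :: 'a poly) = 0" by (simp add: carlitz_def)
  have twisted_0: "twisted_mult CARD('a) f 0 = 0" for f :: "'a poly fract poly"
    by (simp add: twisted_mult_def)
  have fr: "(x + y) ^ CARD('a) = x ^ CARD('a) + y ^ CARD('a)" for x y :: "'a poly fract"
    by (rule frobenius_add_fract)
  show const: "carlitz [:c:] = [:to_fract [:c:]:]" for c :: 'a
    by (simp add: carlitz_pCons carlitz_0 twisted_0)
  show "carlitz [:0, 1 :: 'a:] = carlitz_T"
    by (simp only: carlitz_pCons[of 0] const) (simp flip: one_pCons)
  show add: "carlitz (a + b) = carlitz a + carlitz b" for a b :: "'a poly"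
  proof -
    have "degree a \<le> max (degree a) (degree b)" "degree b \<le> max (degree a) (degree b)"
      "degree (a + b) \<le> max (degree a) (degree b)" by (auto simp: degree_add_le_max)
    note * = this[THEN carlitz_bound]
    have "to_fract [:x + y:] = to_fract [:x:] + to_fract [:y:]" for x y :: 'a
      by (simp flip: to_fract_add)
    thus ?thesis by (simp add: * smult_add_left sum.distrib)
  qed
  have smult: "carlitz (smult c a) = smult (to_fract [:c:]) (carlitz a)" for c and a :: "'a poly"
  proof -
    have "to_fract [:x * y:] = to_fract [:x:] * to_fract [:y:]" for x y :: 'a
      by (simp flip: to_fract_mult)
    thus ?thesis
      using carlitz_bound[OF degree_smult_le[of c a]] by (simp add: carlitz_def smult_sum_right)
  qed
  show "carlitz (a * b) = twisted_mult CARD('a) (carlitz a) (carlitz b)"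
  proof (induction a)
    case 0
    show ?case by (simp add: carlitz_0 twisted_mult_def)
  next
    case (pCons c a)
    show ?case
      by (simp add: mult_pCons_left add smult carlitz_pCons pCons.IH twisted_mult_add_left
          twisted_mult_const_left twisted_mult_assoc[OF fr])
  qed
qed

theorem carlitz_unique:
  fixes \<phi> :: "'a::{finite,field} poly \<Rightarrow> 'a poly fract poly"
  assumes "\<And>a b. \<phi> (a + b) = \<phi> a + \<phi> b"
    and "\<And>a b. \<phi> (a * b) = twisted_mult CARD('a) (\<phi> a) (\<phi> b)"
    and "\<And>c. \<phi> [:c:] = [:to_fract [:c:]:]"
    and "\<phi> [:0, 1:] = carlitz_T"
  shows "\<phi> = carlitz"
proof
  show "\<phi> a = carlitz a" for a
  proof (induction a)
    case 0
    show ?case using assms(3)[of 0] by (simp add: carlitz_def)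
  next
    case (pCons c a)
    have "pCons c a = [:c:] + [:0, 1:] * a" by simp
    hence "\<phi> (pCons c a) = \<phi> [:c:] + twisted_mult CARD('a) (\<phi> [:0, 1:]) (\<phi> a)"
      using assms(1,2) by metis
    thus ?case by (simp add: carlitz_pCons pCons.IH assms)
  qed
qed

lemma is_subfield_adjoin: "is_subfield (adjoin F x)"
  unfolding adjoin_def by (rule hull_in) (auto simp: is_subfield_def)

lemma adjoin_superset: "insert x F \<subseteq> adjoin F x"
  unfolding adjoin_def by (rule hull_subset)

lemma adjoin_minimal: "is_subfield E \<Longrightarrow> insert x F \<subseteq> E \<Longrightarrow> adjoin F x \<subseteq> E"
  unfolding adjoin_def by (rule hull_minimal)

lemma is_subfieldD:
  assumes "is_subfield K"
  shows "1 \<in> K" "0 \<in> K" "x \<in> K \<Longrightarrow> y \<in> K \<Longrightarrow> x - y \<in> K" "x \<in> K \<Longrightarrow> y \<in> K \<Longrightarrow> x + y \<in> K"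
    "x \<in> K \<Longrightarrow> y \<in> K \<Longrightarrow> x * y \<in> K" "x \<in> K \<Longrightarrow> inverse x \<in> K"
proof -
  show 1: "1 \<in> K" and d: "x \<in> K \<Longrightarrow> y \<in> K \<Longrightarrow> x - y \<in> K" for x y
    using assms by (auto simp: is_subfield_def)
  show 0: "0 \<in> K" using d[OF 1 1] by simp
  show "x \<in> K \<Longrightarrow> y \<in> K \<Longrightarrow> x + y \<in> K" using d[OF _ d[OF 0, of y], of x] by simp
qed (use assms in \<open>auto simp: is_subfield_def\<close>)

lemma galois_groupD:
  assumes "\<sigma> \<in> galois_group K F" "is_subfield K" "0 \<in> F" "1 \<in> F"
  shows "x \<in> K \<Longrightarrow> y \<in> K \<Longrightarrow> \<sigma> (x + y) = \<sigma> x + \<sigma> y"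
    "x \<in> K \<Longrightarrow> y \<in> K \<Longrightarrow> \<sigma> (x * y) = \<sigma> x * \<sigma> y"
    "x \<in> K \<Longrightarrow> y \<in> K \<Longrightarrow> \<sigma> (x - y) = \<sigma> x - \<sigma> y"
    "x \<in> K \<Longrightarrow> \<sigma> (inverse x) = inverse (\<sigma> x)"
proof -
  note K = is_subfieldD[OF assms(2)]
  show add: "x \<in> K \<Longrightarrow> y \<in> K \<Longrightarrow> \<sigma> (x + y) = \<sigma> x + \<sigma> y"
    and mult: "x \<in> K \<Longrightarrow> y \<in> K \<Longrightarrow> \<sigma> (x * y) = \<sigma> x * \<sigma> y" for x y
    using assms by (auto simp: galois_group_def)
  show "x \<in> K \<Longrightarrow> y \<in> K \<Longrightarrow> \<sigma> (x - y) = \<sigma> x - \<sigma> y"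
    using add[OF K(3)[of x y], of y] by simp
  show "\<sigma> (inverse x) = inverse (\<sigma> x)" if "x \<in> K"
  proof (cases "x = 0")
    case False
    have "\<sigma> x * \<sigma> (inverse x) = \<sigma> 1"
      using mult[OF that K(6)[OF that]] False by simp
    also have "\<sigma> 1 = 1" using assms by (auto simp: galois_group_def)
    finally show ?thesis by (metis inverse_unique)
  qed (use assms in \<open>auto simp: galois_group_def\<close>)
qed

lemma finite_galois_group:
  fixes l :: "'a::field poly fract alg_closure"
  shows "finite (galois_group (carlitz_field l) base_field)"
proof -
  define K where "K = carlitz_field l"
  define F where "F = (base_field :: 'a poly fract alg_closure set)"
  define G where "G = galois_group K F"
  have K: "is_subfield K" "insert l F \<subseteq> K"
    by (auto simp: K_def F_def carlitz_field_def is_subfield_adjoin intro!: set_mp[OF adjoin_superset])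
  note K' = is_subfieldD[OF K(1)]
  have F: "0 \<in> F" "1 \<in> F"
    unfolding F_def base_field_def by (metis to_ac_0 rangeI, metis to_ac_1 rangeI)
  note hom = galois_groupD[OF _ K(1) F, folded G_def]
  have "inj_on (\<lambda>\<sigma>. \<sigma> l) G"
  proof (rule inj_onI)
    fix \<sigma> \<tau> assume st: "\<sigma> \<in> G" "\<tau> \<in> G" "\<sigma> l = \<tau> l"
    define E where "E = {x \<in> K. \<sigma> x = \<tau> x}"
    have eqF: "\<sigma> x = x" "\<tau> x = x" if "x \<in> F" for x
      using st that by (auto simp: G_def galois_group_def)
    have "is_subfield E"
      unfolding is_subfield_def E_def using K' hom[OF st(1)] hom[OF st(2)] eqF F by auto
    moreover have "insert l F \<subseteq> E" using st eqF K(2) by (auto simp: E_def)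
    ultimately have "K \<subseteq> E"
      unfolding K_def carlitz_field_def F_def by (rule adjoin_minimal)
    thus "\<sigma> = \<tau>"
      using st by (intro extensionalityI[of _ K]) (auto simp: E_def G_def galois_group_def)
  qed
  moreover obtain p where p: "p \<noteq> 0" "poly (map_poly to_ac p) l = 0"
    by (rule alg_closure_algebraic)
  have "(\<lambda>\<sigma>. \<sigma> l) ` G \<subseteq> {x. poly (map_poly to_ac p) x = 0}"
  proof safe
    fix \<sigma> assume s: "\<sigma> \<in> G"
    have eqF: "\<sigma> (to_ac x) = to_ac x" for x
      using s by (auto simp: G_def galois_group_def F_def base_field_def)
    have inK: "to_ac x \<in> K" "l \<in> K" for x using K(2) by (auto simp: F_def base_field_def)
    have "poly (map_poly to_ac r) l \<in> K \<and>
          \<sigma> (poly (map_poly to_ac r) l) = poly (map_poly to_ac r) (\<sigma> l)" for r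
    proof (induction r)
      case 0
      show ?case using K'(2) eqF[of 0] by simp
    next
      case (pCons c r)
      thus ?case using inK K'(4,5) hom(1,2)[OF s] eqF by (simp add: map_poly_pCons)
    qed
    from this[of p] p show "poly (map_poly to_ac p) (\<sigma> l) = 0"
      using eqF[of 0] by simp
  qed
  moreover have "finite {x. poly (map_poly to_ac p) x = 0}"
    using p(1) by (intro poly_roots_finite) (auto simp: map_poly_eq_0_iff)
  ultimately show ?thesis
    unfolding G_def K_def F_def using finite_imageD finite_subset by blast
qed

end

theory Submission
  imports Defs
begin

text \<open>
  Let \<open>f = C\<^sub>P(x)/x\<close>, let \<open>\<lambda>\<^sub>n = C_{g^n}(\<lambda>)\<close> be its roots and \<open>N = q^d - 1\<close> its degree. The quotients \<open>\<lambda>\<^sub>n/\<lambda>\<close>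
  are units of \<open>R = A[\<lambda>]\<close>, and \<open>f(0) = P\<close> is their product times \<open>\<plusminus>\<lambda>^N\<close>. A nontrivial factor of \<open>f\<close> with
  unit constant term would make \<open>\<lambda>\<close>, hence \<open>P\<close>, a unit of \<open>R\<close>, which is impossible, so \<open>f\<close> is irreducible.
  For a prime \<open>\<pi> \<noteq> P\<close> the derivative of \<open>C\<^sub>P\<close> is the nonzero constant \<open>P\<close> modulo \<open>\<pi>\<close>, so \<open>R/\<pi>R\<close> is
  reduced, while \<open>R/\<lambda>R = A/P\<close> is a field. These two facts replace all ideal theory: they show that
  \<open>R\<close> is integrally closed, and that an element \<open>\<alpha>\<close> of \<open>R\<close> that is associated to its conjugates is
  \<open>\<lambda>^m a \<eta>\<close> with \<open>a \<in> A\<close> and a unit \<open>\<eta>\<close>, because \<open>\<alpha>^N\<close> is then its norm up to a unit. Hilbert 90 writes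
  \<open>\<epsilon> = \<alpha>/\<sigma>(\<alpha>)\<close> for such an \<open>\<alpha>\<close>.
\<close>

subsection \<open>Polynomials under ring homomorphisms\<close>

text \<open>Its instances include the embedding of A into the closure of k, reduction of A modulo a
  prime with values in the closure of F_q, and evaluation of polynomials at a point.\<close>

locale comm_ring_map =
  fixes h :: "'b::idom \<Rightarrow> 'c::idom"
  assumes map_one [simp]: "h 1 = 1"
    and map_add [simp]: "h (x + y) = h x + h y"
    and map_mult [simp]: "h (x * y) = h x * h y"
begin

lemma map_zero [simp]: "h 0 = 0"
  using map_add[of 0 0] by (metis add_cancel_right_right)

lemma map_minus [simp]: "h (- x) = - h x"
  using map_add[of "- x" x] by (simp add: eq_neg_iff_add_eq_0)

lemma map_diff [simp]: "h (x - y) = h x - h y"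
  using map_add[of x "- y"] by simp

lemma map_power [simp]: "h (x ^ n) = h x ^ n"
  by (induction n) auto

lemma map_sum: "h (sum u A) = (\<Sum>i\<in>A. h (u i))"
  by (induction A rule: infinite_finite_induct) auto

lemma map_prod: "h (prod u A) = (\<Prod>i\<in>A. h (u i))"
  by (induction A rule: infinite_finite_induct) auto

lemma map_poly_map_add [simp]: "map_poly h (p + q) = map_poly h p + map_poly h q"
  by (rule poly_eqI) (simp add: coeff_map_poly)

lemma map_poly_map_minus [simp]: "map_poly h (- p) = - map_poly h p"
  by (rule poly_eqI) (simp add: coeff_map_poly)

lemma map_poly_map_diff [simp]: "map_poly h (p - q) = map_poly h p - map_poly h q"
  by (rule poly_eqI) (simp add: coeff_map_poly)

lemma map_poly_map_smult [simp]: "map_poly h (smult c p) = smult (h c) (map_poly h p)"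
  by (rule poly_eqI) (simp add: coeff_map_poly)

lemma map_poly_map_pCons [simp]: "map_poly h (pCons c p) = pCons (h c) (map_poly h p)"
  by (simp add: map_poly_pCons)

lemma map_poly_map_mult [simp]: "map_poly h (p * q) = map_poly h p * map_poly h q"
  by (induction p) (simp_all add: mult_pCons_left)

lemma map_poly_map_one [simp]: "map_poly h 1 = 1"
  by (simp add: one_pCons)

lemma comm_ring_map_map_poly: "comm_ring_map (map_poly h)"
  by unfold_locales auto

lemma map_poly_map_power [simp]: "map_poly h (p ^ n) = map_poly h p ^ n"
  by (induction n) auto

lemma map_poly_map_prod: "map_poly h (prod u A) = (\<Prod>i\<in>A. map_poly h (u i))"
  by (rule comm_ring_map.map_prod[OF comm_ring_map_map_poly])

lemma comm_ring_map_poly: "comm_ring_map (\<lambda>p. poly (map_poly h p) x)"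
  by unfold_locales auto

lemma poly_map_poly_pcompose [simp]:
  "poly (map_poly h (pcompose p q)) x = poly (map_poly h p) (poly (map_poly h q) x)"
  by (induction p) (auto simp: pcompose_pCons)

lemma pderiv_map_poly_map: "pderiv (map_poly h p) = map_poly h (pderiv p)"
  by (induction p) (simp_all add: pderiv_pCons)

lemma degree_map_poly_monic:
  assumes "lead_coeff p = 1"
  shows "degree (map_poly h p) = degree p"
  using assms by (intro antisym degree_le le_degree) (auto simp: coeff_map_poly coeff_eq_0)

lemma lead_coeff_map_poly_monic:
  assumes "lead_coeff p = 1"
  shows "lead_coeff (map_poly h p) = 1"
  using assms by (simp add: degree_map_poly_monic coeff_map_poly)

end

section \<open>Simple roots, monic division and Bezout identities\<close>

lemma card_roots_eq_degree:
  fixes p :: "'k::alg_closed_field poly"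
  assumes "p \<noteq> 0" and "\<And>x. poly p x = 0 \<Longrightarrow> poly (pderiv p) x \<noteq> 0"
  shows "card {x. poly p x = 0} = degree p"
  using assms
proof (induction "degree p" arbitrary: p)
  case 0
  then obtain c where "p = [:c:]" "c \<noteq> 0"
    by (auto elim!: degree_eq_zeroE)
  then show ?case by simp
next
  case (Suc n)
  then obtain x where x: "poly p x = 0"
    using alg_closed_imp_poly_has_root[of p] by auto
  then obtain r where r: "p = [:- x, 1:] * r"
    by (auto simp: poly_eq_0_iff_dvd elim: dvdE)
  have "r \<noteq> 0" using Suc.prems r by auto
  then have deg: "degree p = Suc (degree r)"
    unfolding r by (subst degree_mult_eq) auto
  \<comment> \<open>The product rule for \<open>p = (X - x) r\<close>. At \<open>x\<close> it shows
    that the split-off root is not a root of \<open>r\<close>; at a root of \<open>r\<close> it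
    shows that \<open>r\<close> inherits the hypothesis.\<close>
  have dp: "poly (pderiv p) y = poly r y + (y - x) * poly (pderiv r) y" for y
    unfolding r pderiv_mult by (simp add: pderiv_pCons algebra_simps)
  have rx: "poly r x \<noteq> 0"
    using Suc.prems(2)[OF x] dp by simp
  have "card {y. poly r y = 0} = degree r"
  proof (rule Suc.hyps(1))
    fix y assume y: "poly r y = 0"
    then have "poly (pderiv p) y \<noteq> 0" using Suc.prems(2)[of y] r by simp
    then show "poly (pderiv r) y \<noteq> 0" using dp[of y] y by auto
  qed (use Suc.hyps(2) deg \<open>r \<noteq> 0\<close> in auto)
  moreover have "{y. poly p y = 0} = insert x {y. poly r y = 0}"
    unfolding r by auto
  ultimately show ?case
    using rx \<open>r \<noteq> 0\<close> deg by (simp add: poly_roots_finite)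
qed

lemma monic_division:
  fixes f Q :: "'b::idom poly"
  assumes "lead_coeff f = 1" "degree f > 0"
  shows "\<exists>W S. Q = f * W + S \<and> degree S < degree f"
proof (induction "degree Q" arbitrary: Q rule: less_induct)
  case less
  show ?case
  proof (cases "degree Q < degree f")
    case True
    then show ?thesis by (intro exI[of _ 0] exI[of _ Q]) auto
  next
    case False
    define t where "t = monom (lead_coeff Q) (degree Q - degree f)"
    have Q: "degree Q > 0" "lead_coeff Q \<noteq> 0" using False assms(2) by auto
    have t: "degree t = degree Q - degree f" "t \<noteq> 0"
      using Q by (auto simp: t_def degree_monom_eq)
    have dft: "degree (f * t) = degree Q"
      using t False assms by (subst degree_mult_eq) auto
    have "lead_coeff (f * t) = lead_coeff Q"
      unfolding lead_coeff_mult using assms(1) Q by (simp add: t_def degree_monom_eq)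
    then have "coeff (Q - f * t) (degree Q) = 0" by (simp add: dft)
    moreover have "degree (Q - f * t) \<le> degree Q"
      using dft by (simp add: degree_diff_le)
    ultimately have "degree (Q - f * t) < degree Q"
      using Q(1) by (metis coeff_0 degree_0 le_neq_implies_less leading_coeff_0_iff)
    from less[OF this] obtain W S where "Q - f * t = f * W + S" "degree S < degree f" by blast
    then show ?thesis
      by (intro exI[of _ "W + t"] exI[of _ S]) (simp add: algebra_simps)
  qed
qed

text \<open>A nonzero element of least degree in the ideal generated by \<open>a\<close> and
  \<open>b\<close> divides every element of it, so coprimality makes it a unit.\<close>

lemma field_poly_bezout:
  fixes a b :: "'b::field poly"
  assumes "coprime a b"
  shows "\<exists>u v. u * a + v * b = 1"
proof -
  define J where "J = {u * a + v * b | u v. True}"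
  have "\<exists>m\<in>J - {0}. \<forall>y\<in>J - {0}. degree m \<le> degree y" if "J - {0} \<noteq> {}"
    using that ex_has_least_nat[of "\<lambda>y. y \<in> J - {0}" _ degree] by blast
  moreover have "J - {0} \<noteq> {}"
  proof
    assume J0: "J - {0} = {}"
    have "1 * a + 0 * b \<in> J" "0 * a + 1 * b \<in> J" unfolding J_def by blast+
    then have "a = 0" "b = 0" using J0 by auto
    then show False using assms by simp
  qed
  ultimately obtain m where m: "m \<in> J" "m \<noteq> 0" "\<And>y. y \<in> J \<Longrightarrow> y \<noteq> 0 \<Longrightarrow> degree m \<le> degree y"
    by blast
  from m(1) obtain u v where uv: "m = u * a + v * b" by (auto simp: J_def)
  have dvd: "m dvd y" if "y \<in> J" for y
  proof (rule ccontr)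
    assume "\<not> m dvd y"
    then have n0: "y mod m \<noteq> 0" by (simp add: mod_eq_0_iff_dvd)
    from that obtain u' v' where "y = u' * a + v' * b" by (auto simp: J_def)
    then have "y mod m = (u' - y div m * u) * a + (v' - y div m * v) * b"
      unfolding uv by (simp add: minus_div_mult_eq_mod[symmetric] algebra_simps)
    then have "y mod m \<in> J" by (auto simp: J_def)
    with m(3) n0 show False using degree_mod_less'[of m y] m(2) by (auto simp: not_le[symmetric])
  qed
  have "1 * a + 0 * b \<in> J" "0 * a + 1 * b \<in> J" unfolding J_def by blast+
  then have "m dvd a" "m dvd b" using dvd by auto
  then have "m dvd 1" using assms coprime_common_divisor by blast
  then obtain w where "1 = m * w" by (elim dvdE)
  then have "(w * u) * a + (w * v) * b = 1" unfolding uv by (simp add: algebra_simps)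
  then show ?thesis by blast
qed

section \<open>Irreducible polynomials and their residue fields\<close>

lemma irreducible_coprime_if_not_dvd:
  fixes p :: "'b::algebraic_semidom"
  assumes "irreducible p" "\<not> p dvd a"
  shows "coprime a p"
proof (rule coprimeI)
  fix c assume c: "c dvd a" "c dvd p"
  then obtain e where e: "p = c * e" by (elim dvdE)
  then have "is_unit c \<or> is_unit e" using assms(1) by (auto simp: irreducible_def)
  moreover have False if "is_unit e"
    using that c e assms(2) by (metis dvd_trans mult_unit_dvd_iff dvd_refl)
  ultimately show "is_unit c" by blast
qed

interpretation to_ac: comm_ring_map "to_ac :: 'b::field \<Rightarrow> 'b alg_closure"
  by unfold_locales auto

text \<open>Evaluation at a root \<theta> of \<open>c\<close> has as kernel the multiples of the
  minimal polynomial \<open>p\<close> of \<theta>. It embeds the residue field at \<open>p\<close>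
  in an algebraically closed field and so serves as reduction modulo \<open>p\<close> without
  quotient rings. The lemma also supplies an irreducible factor of \<open>c\<close>.\<close>

lemma ex_residue_root:
  fixes c :: "'b::field poly"
  assumes "degree c > 0"
  obtains \<theta> :: "'b alg_closure" and p where
    "irreducible p" "degree p > 0" "p dvd c" "\<And>a. poly (map_poly to_ac a) \<theta> = 0 \<longleftrightarrow> p dvd a"
proof -
  have "degree (map_poly to_ac c) > 0"
    using assms by (subst degree_map_poly) auto
  then obtain \<theta> :: "'b alg_closure" where \<theta>: "poly (map_poly to_ac c) \<theta> = 0"
    using alg_closed_imp_poly_has_root by blast
  define e where "e a = poly (map_poly to_ac a) \<theta>" for a
  interpret e: comm_ring_map e
    unfolding e_def by (rule to_ac.comm_ring_map_poly)
  have "c \<noteq> 0 \<and> e c = 0" using \<theta> assms by (auto simp: e_def)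
  then obtain p where p: "p \<noteq> 0" "e p = 0"
    and min: "\<And>y. y \<noteq> 0 \<Longrightarrow> e y = 0 \<Longrightarrow> degree p \<le> degree y"
    using ex_has_least_nat[of "\<lambda>y. y \<noteq> 0 \<and> e y = 0" c degree] by blast
  have ker: "e a = 0 \<longleftrightarrow> p dvd a" for a
  proof
    assume a: "e a = 0"
    have "e (a mod p) = 0"
      using a p(2) by (simp add: minus_div_mult_eq_mod[symmetric])
    then have "a mod p = 0"
      using min[of "a mod p"] degree_mod_less'[of p a] p(1) by fastforce
    then show "p dvd a" by (simp add: mod_eq_0_iff_dvd)
  qed (use p(2) in \<open>auto elim!: dvdE\<close>)
  have nu: "\<not> is_unit p" using ker[of 1] by auto
  then have deg: "degree p > 0" using p(1) by (simp add: is_unit_iff_degree)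
  have "irreducible p"
  proof (rule irreducibleI)
    fix u v assume uv: "p = u * v"
    then have uv0: "u \<noteq> 0" "v \<noteq> 0" using p(1) by auto
    have "e u = 0 \<or> e v = 0" using p(2) uv by auto
    then have "degree p \<le> degree u \<or> degree p \<le> degree v" using min uv0 by blast
    moreover have "degree p = degree u + degree v" using uv uv0 by (simp add: degree_mult_eq)
    ultimately show "is_unit u \<or> is_unit v" using uv0 by (auto simp: is_unit_iff_degree)
  qed (use p nu in auto)
  moreover have "p dvd c" using ker[of c] \<theta> by (simp add: e_def)
  ultimately show ?thesis using that[of p \<theta>] deg ker by (auto simp: e_def)
qed

lemma irreducible_dvd_irreducible:
  fixes p r :: "'b::algebraic_semidom"
  assumes "irreducible p" "irreducible r" "p dvd r"
  shows "r dvd p"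
proof -
  from assms(3) obtain e where e: "r = p * e" by (elim dvdE)
  then have "is_unit p \<or> is_unit e" using assms(2) by (auto simp: irreducible_def)
  then have "is_unit e" using assms(1) by (auto simp: irreducible_def)
  then show ?thesis unfolding e by (metis mult_unit_dvd_iff dvd_refl)
qed

lemma ex_residue_root_irreducible:
  fixes p :: "'b::field poly"
  assumes "irreducible p"
  obtains \<theta> :: "'b alg_closure" where "\<And>a. poly (map_poly to_ac a) \<theta> = 0 \<longleftrightarrow> p dvd a"
proof -
  have "degree p > 0" using assms by (auto simp: irreducible_def is_unit_iff_degree)
  then obtain \<theta> :: "'b alg_closure" and r where r: "irreducible r" "r dvd p"
    "\<And>a. poly (map_poly to_ac a) \<theta> = 0 \<longleftrightarrow> r dvd a" by (rule ex_residue_root) blast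
  have "p dvd r" using irreducible_dvd_irreducible[OF r(1) assms r(2)] .
  then have "poly (map_poly to_ac a) \<theta> = 0 \<longleftrightarrow> p dvd a" for a
    using r(2,3) dvd_trans by blast
  then show ?thesis by (rule that)
qed

lemma ex_map_poly_eq:
  assumes "\<And>i. coeff F i \<in> range h" "h 0 = 0"
  shows "\<exists>p. map_poly h p = F"
  using assms(1)
proof (induction F)
  case 0
  then show ?case by (intro exI[of _ 0]) simp
next
  case (pCons c F)
  have "coeff F i \<in> range h" for i using pCons.prems[of "Suc i"] by simp
  then obtain p where "map_poly h p = F" using pCons.IH by blast
  moreover obtain a where "h a = c" using pCons.prems[of 0] by auto
  ultimately have "map_poly h (pCons a p) = pCons c F" using assms(2) by (simp add: map_poly_pCons)
  then show ?case by blast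
qed

text \<open>A residue root turns divisibility by \<open>p\<close> into vanishing in a field, so
  irreducible elements are prime.\<close>

lemma irreducible_dvd_mult_iff:
  fixes p :: "'b::field poly"
  assumes "irreducible p"
  shows "p dvd a * b \<longleftrightarrow> p dvd a \<or> p dvd b"
proof -
  obtain \<theta> :: "'b alg_closure" where \<theta>: "\<And>a. poly (map_poly to_ac a) \<theta> = 0 \<longleftrightarrow> p dvd a"
    using ex_residue_root_irreducible[OF assms] by blast
  show ?thesis by (simp flip: \<theta>)
qed

lemma irreducible_dvd_power:
  fixes p :: "'b::field poly"
  assumes "irreducible p" "p dvd a ^ n"
  shows "p dvd a"
  using assms(2)
proof (induction n)
  case 0
  then show ?case using assms(1) by (simp add: irreducible_def)
next
  case (Suc n)
  then show ?case using irreducible_dvd_mult_iff[OF assms(1)] by auto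
qed

lemma units_inI: "x \<in> S \<Longrightarrow> inverse x \<in> S \<Longrightarrow> x \<noteq> 0 \<Longrightarrow> x \<in> units_in S"
  by (auto simp: units_in_def intro!: bexI[of _ "inverse x"])

lemma units_inD:
  fixes x :: "'k::field"
  assumes "x \<in> units_in S"
  shows "x \<in> S" "inverse x \<in> S" "x \<noteq> 0"
proof -
  obtain v where "x \<in> S" "v \<in> S" "x * v = 1" using assms by (auto simp: units_in_def)
  moreover from this have "inverse x = v" by (intro inverse_unique)
  ultimately show "x \<in> S" "inverse x \<in> S" "x \<noteq> 0" by auto
qed

subsection \<open>Carlitz polynomials\<close>

interpretation emb: comm_ring_map "poly_to_ac :: 'b::field poly \<Rightarrow> 'b poly fract alg_closure"
  by unfold_locales (auto simp: poly_to_ac_def)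

lemma poly_to_ac_eq_iff [simp]: "poly_to_ac a = poly_to_ac b \<longleftrightarrow> a = b"
  by (simp add: poly_to_ac_def)

lemma poly_to_ac_eq_0_iff [simp]: "poly_to_ac a = 0 \<longleftrightarrow> a = 0"
  using poly_to_ac_eq_iff[of a 0] by simp

lemma frobenius_add_ac:
  fixes x y :: "'a::{finite,field} poly fract alg_closure"
  shows "(x + y) ^ CARD('a) = x ^ CARD('a) + y ^ CARD('a)"
proof (rule frobenius_add[of "\<lambda>c. poly_to_ac [:c:]"])
  show "poly_to_ac [:c::'a:] ^ CARD('a) = poly_to_ac [:c:]" for c
    unfolding poly_to_ac_def by (simp add: to_fract_const(3) flip: to_ac_power)
qed (auto simp: inj_def simp flip: emb.map_diff)

lemma frobenius_sum_ac:
  fixes u :: "'i \<Rightarrow> 'a::{finite,field} poly fract alg_closure"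
  shows "(sum u I) ^ CARD('a) = (\<Sum>i\<in>I. u i ^ CARD('a))"
  by (induction I rule: infinite_finite_induct) (auto simp: frobenius_add_ac zero_power)

text \<open>The action of twisted polynomials on the closure, with \<tau> acting as the q-th power;
  \<open>carlitz_eval a\<close> is the action of \<open>carlitz a\<close>.\<close>

definition twisted_eval :: "'a::{finite,field} poly fract poly \<Rightarrow>
    'a poly fract alg_closure \<Rightarrow> 'a poly fract alg_closure" where
  "twisted_eval F x = (\<Sum>i\<le>degree F. to_ac (coeff F i) * x ^ (CARD('a) ^ i))"

lemma twisted_eval_bound:
  fixes F :: "'a::{finite,field} poly fract poly"
  assumes "degree F \<le> n"
  shows "twisted_eval F x = (\<Sum>i\<le>n. to_ac (coeff F i) * x ^ (CARD('a) ^ i))"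
  unfolding twisted_eval_def
  by (rule sum.mono_neutral_left) (use assms in \<open>auto simp: coeff_eq_0\<close>)

lemma twisted_eval_add: "twisted_eval (F + G) x = twisted_eval F x + twisted_eval G x"
proof -
  define n where "n = max (degree F) (degree G)"
  have "degree F \<le> n" "degree G \<le> n" "degree (F + G) \<le> n"
    by (auto simp: n_def degree_add_le_max)
  then show ?thesis by (simp add: twisted_eval_bound[of _ n] sum.distrib algebra_simps)
qed

lemma twisted_eval_smult: "twisted_eval (smult c F) x = to_ac c * twisted_eval F x"
  using twisted_eval_bound[OF degree_smult_le[of c F]]
  by (simp add: twisted_eval_def sum_distrib_left mult.assoc)

text \<open>By \<open>\<tau> c = c^q \<tau>\<close> the twisted polynomial on the left is \<tau>
  times \<open>F\<close>, and \<tau> acts as the additive q-th power map.\<close>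

lemma twisted_eval_frobenius:
  fixes F :: "'a::{finite,field} poly fract poly"
  shows "twisted_eval (pCons 0 (map_poly (\<lambda>c. c ^ CARD('a)) F)) x = twisted_eval F x ^ CARD('a)"
proof -
  let ?G = "map_poly (\<lambda>c. c ^ CARD('a)) F"
  have "degree ?G \<le> degree F"
    by (rule degree_le) (auto simp: coeff_map_poly coeff_eq_0)
  then have "degree (pCons 0 ?G) \<le> Suc (degree F)"
    by (meson degree_pCons_le le_trans Suc_le_mono)
  then have "twisted_eval (pCons 0 ?G) x =
      (\<Sum>i\<le>Suc (degree F). to_ac (coeff (pCons 0 ?G) i) * x ^ (CARD('a) ^ i))"
    by (rule twisted_eval_bound)
  also have "\<dots> = (\<Sum>i\<le>degree F. (to_ac (coeff F i) * x ^ (CARD('a) ^ i)) ^ CARD('a))"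
    by (subst sum.atMost_Suc_shift)
       (simp add: coeff_map_poly zero_power power_mult_distrib mult.commute[of "CARD('a)"] flip: power_mult)
  finally show ?thesis by (simp add: twisted_eval_def frobenius_sum_ac)
qed

text \<open>The relation C_{c + T a} = c + (T + \<tau>) C_a evaluated at \<open>x\<close>, the
  recursion behind later inductions on \<open>a\<close>.\<close>

lemma carlitz_eval_pCons:
  fixes a :: "'a::{finite,field} poly"
  shows "carlitz_eval (pCons c a) x =
    poly_to_ac [:c:] * x + poly_to_ac [:0, 1:] * carlitz_eval a x + carlitz_eval a x ^ CARD('a)"
proof -
  have "twisted_mult CARD('a) carlitz_T (carlitz a) =
      smult (to_fract [:0, 1:]) (carlitz a) + pCons 0 (map_poly (\<lambda>c. c ^ CARD('a)) (carlitz a))"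
    by (simp add: twisted_mult_def carlitz_T_def monom_Suc map_poly_idI)
  moreover have "twisted_eval [:to_fract [:c:]:] x = poly_to_ac [:c:] * x"
    by (simp add: twisted_eval_def poly_to_ac_def)
  moreover have "carlitz_eval b x = twisted_eval (carlitz b) x" for b
    by (simp add: carlitz_eval_def twisted_eval_def)
  ultimately show ?thesis
    by (simp add: carlitz_pCons twisted_eval_add twisted_eval_smult twisted_eval_frobenius poly_to_ac_def)
qed

lemma carlitz_eval_0 [simp]: "carlitz_eval 0 x = 0"
  by (simp add: carlitz_eval_def carlitz_def)

lemma carlitz_eval_1 [simp]: "carlitz_eval 1 x = x"
  using carlitz_eval_pCons[of 1 0 x] by (simp add: zero_power flip: one_pCons)

lemma carlitz_eval_at_0 [simp]: "carlitz_eval a 0 = 0"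
  by (induction a) (auto simp: carlitz_eval_pCons zero_power)

lemma carlitz_eval_add: "carlitz_eval (a + b) x = carlitz_eval a x + carlitz_eval b x"
proof -
  have "carlitz_eval a x = twisted_eval (carlitz a) x" for a
    by (simp add: carlitz_eval_def twisted_eval_def)
  then show ?thesis by (simp add: carlitz_hom(1) twisted_eval_add)
qed

lemma carlitz_eval_smult: "carlitz_eval (smult c a) x = poly_to_ac [:c:] * carlitz_eval a x"
proof (induction a)
  case (pCons d a)
  have "poly_to_ac [:c:] ^ CARD('a) = poly_to_ac [:c:]"
    unfolding poly_to_ac_def by (simp add: to_fract_const(3) flip: to_ac_power)
  moreover have "poly_to_ac [:c * d:] = poly_to_ac [:c:] * poly_to_ac [:d:]"
    by (simp flip: emb.map_mult)
  ultimately show ?case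
    by (simp add: pCons.IH carlitz_eval_pCons power_mult_distrib algebra_simps)
qed auto

lemma carlitz_eval_mult: "carlitz_eval (a * b) x = carlitz_eval a (carlitz_eval b x)"
proof (induction a)
  case (pCons c a)
  then show ?case
    by (simp add: mult_pCons_left carlitz_eval_add carlitz_eval_smult carlitz_eval_pCons)
qed auto

text \<open>C_a(x) as an element of A[x]. The recursion C_{c + T a}(x) = c x + T C_a(x) + C_a(x)^q
  keeps the coefficients in A by construction, whereas the twisted polynomial has them in k.\<close>

definition carlitz_poly :: "'a::{finite,field} poly \<Rightarrow> 'a poly poly" where
  "carlitz_poly a =
     fold_coeffs (\<lambda>c p. [:0, [:c:]:] + smult [:0, 1:] p + p ^ CARD('a)) a 0"

lemma carlitz_poly_0 [simp]: "carlitz_poly 0 = 0"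
  by (simp add: carlitz_poly_def)

lemma carlitz_poly_pCons:
  fixes a :: "'a::{finite,field} poly"
  shows "carlitz_poly (pCons c a) =
    [:0, [:c:]:] + smult [:0, 1:] (carlitz_poly a) + carlitz_poly a ^ CARD('a)"
proof (cases "c = 0 \<and> a = 0")
  case False
  then show ?thesis by (auto simp: carlitz_poly_def)
qed (auto simp: zero_power)

lemma carlitz_eval_eq: "carlitz_eval a x = poly_at (carlitz_poly a) x"
  by (induction a) (simp_all add: carlitz_eval_pCons carlitz_poly_pCons mult.commute)

lemma coeff_0_carlitz_poly [simp]: "coeff (carlitz_poly a) 0 = 0"
  by (induction a) (simp_all add: carlitz_poly_pCons coeff_0_power zero_power)

text \<open>Translation by 1 permutes the field, so the sum of all elements is unchanged when q ones
  are added to it.\<close>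

lemma of_nat_card_eq_0: "of_nat CARD('a::{finite,field}) = (0 :: 'a)"
proof -
  have "(\<Sum>x\<in>(UNIV::'a set). x + 1) = (\<Sum>x\<in>UNIV. x)"
    by (rule sum.reindex_bij_betw[of "\<lambda>x. x + 1" UNIV UNIV "\<lambda>x. x"])
       (rule bij_betwI[of _ _ _ "\<lambda>x. x - 1"], auto)
  then show ?thesis by (simp add: sum.distrib)
qed

text \<open>The q-th powers have derivative zero, so only the linear coefficient survives. This
  constant derivative is the source of the separability used below.\<close>

lemma pderiv_carlitz_poly: "pderiv (carlitz_poly a) = [:a:]"
proof (induction a)
  case (pCons c a)
  have "(of_nat CARD('a) :: 'a poly) = 0"
    using of_nat_card_eq_0[where 'a='a] by (simp add: of_nat_poly)
  then have "pderiv (carlitz_poly a ^ CARD('a)) = 0"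
    by (simp add: pderiv_power)
  then show ?case
    by (simp add: carlitz_poly_pCons pderiv_add pderiv_smult pCons.IH pderiv_pCons)
qed simp

lemma degree_carlitz_poly:
  fixes a :: "'a::{finite,field} poly"
  assumes "a \<noteq> 0"
  shows "degree (carlitz_poly a) = CARD('a) ^ degree a"
    "lead_coeff (carlitz_poly a) = [:lead_coeff a:]"
proof -
  have "degree (carlitz_poly a) = CARD('a) ^ degree a \<and>
      lead_coeff (carlitz_poly a) = [:lead_coeff a:]"
    using assms
  proof (induction a)
    case (pCons c a)
    show ?case
    proof (cases "a = 0")
      case True
      then show ?thesis using pCons by (auto simp: carlitz_poly_pCons zero_power)
    next
      case False
      let ?p = "carlitz_poly a" and ?q = "CARD('a)"
      have IH: "degree ?p = ?q ^ degree a" "lead_coeff ?p = [:lead_coeff a:]"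
        using pCons False by auto
      have q: "?q \<ge> 2" by (rule card_field_ge_2)
      have p0: "?p \<noteq> 0" using IH(2) False by auto
      have dq: "degree (?p ^ ?q) = ?q ^ Suc (degree a)"
        using p0 IH(1) by (simp add: degree_power_eq mult.commute)
      have lq: "lead_coeff (?p ^ ?q) = [:lead_coeff a:]"
        using IH(2) by (simp add: lead_coeff_power finite_field_power_card poly_const_pow)
      have small: "degree ([:0, [:c:]:] + smult [:0, 1:] ?p) < degree (?p ^ ?q)"
      proof -
        have "1 \<le> ?q ^ degree a" using q by simp
        then have "degree ([:0, [:c:]:] + smult [:0, 1:] ?p) \<le> ?q ^ degree a"
          using IH(1) by (intro degree_add_le order.trans[OF degree_smult_le]) auto
        also have "\<dots> < ?q ^ Suc (degree a)"
          using q by (intro power_strict_increasing) auto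
        finally show ?thesis by (simp add: dq)
      qed
      have d: "degree (carlitz_poly (pCons c a)) = degree (?p ^ ?q)"
        unfolding carlitz_poly_pCons using small by (rule degree_add_eq_right)
      moreover have "lead_coeff (carlitz_poly (pCons c a)) = lead_coeff (?p ^ ?q)"
        unfolding carlitz_poly_pCons using small by (rule lead_coeff_add_le)
      ultimately show ?thesis using dq lq False by simp
    qed
  qed simp
  then show "degree (carlitz_poly a) = CARD('a) ^ degree a"
    "lead_coeff (carlitz_poly a) = [:lead_coeff a:]" by auto
qed

section \<open>Fractions over A and minimal polynomials with coefficients in A\<close>

lemma to_ac_eq_quotient:
  fixes z :: "'b::field poly fract"
  obtains a b where "b \<noteq> 0" "poly_to_ac b * to_ac z = poly_to_ac a"
proof -
  obtain a b where "z = Fract a b" "b \<noteq> 0" by (cases z)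
  then have "poly_to_ac b * to_ac z = poly_to_ac a"
    by (simp add: Fract_conv_to_fract poly_to_ac_def)
  with \<open>b \<noteq> 0\<close> show ?thesis by (rule that)
qed

text \<open>A form of Gauss's lemma. Among annihilators \<open>S\<close> of least degree that divide
  some \<open>smult c f\<close> with \<open>c \<noteq> 0\<close>, one with \<open>c\<close> of least
  degree has constant \<open>c\<close>, since a prime factor of \<open>c\<close> could otherwise be
  cancelled.\<close>

lemma monic_minimal_polynomial:
  fixes f :: "'b::field poly poly"
  assumes "lead_coeff f = 1" "poly_at f x = 0"
  obtains m where "lead_coeff m = 1" "degree m > 0" "\<And>Q. poly_at Q x = 0 \<longleftrightarrow> m dvd Q"
proof -
  have "f \<noteq> 0" using assms(1) by auto
  with assms(2) obtain s where s: "s \<noteq> 0 \<and> poly_at s x = 0"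
    and s_min: "\<And>y. y \<noteq> 0 \<Longrightarrow> poly_at y x = 0 \<Longrightarrow> degree s \<le> degree y"
    using ex_has_least_nat[of "\<lambda>y. y \<noteq> 0 \<and> poly_at y x = 0" f degree] by blast
  define G where "G c S \<longleftrightarrow> c \<noteq> 0 \<and> degree S = degree s \<and> poly_at S x = 0 \<and> (\<exists>W. smult c f = S * W)"
    for c S
  \<comment> \<open>Pseudo-division stands in for division over k: the remainder vanishes at
    \<open>x\<close> and has smaller degree than \<open>s\<close>, hence is zero.\<close>
  obtain c W where c: "c \<noteq> 0" "smult c f = s * W + pseudo_mod f s"
    using pseudo_mod(1)[of s f] s by blast
  have "poly_at (pseudo_mod f s) x = 0"
    using arg_cong[OF c(2), of "\<lambda>Q. poly_at Q x"] s assms(2) by simp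
  then have "pseudo_mod f s = 0"
    using s_min[of "pseudo_mod f s"] pseudo_mod(2)[of s f] s by fastforce
  then have "G c s" using c s by (auto simp: G_def)
  then obtain c where c: "\<exists>S. G c S" and c_min: "\<And>c' S. G c' S \<Longrightarrow> degree c \<le> degree c'"
    using ex_has_least_nat[of "\<lambda>c. \<exists>S. G c S" c degree] by blast
  then obtain S W where S: "c \<noteq> 0" "degree S = degree s" "poly_at S x = 0" "smult c f = S * W"
    by (auto simp: G_def)
  have "degree c = 0"
  proof (rule ccontr)
    assume "degree c \<noteq> 0"
    then have "degree c > 0" by simp
    then obtain \<theta> :: "'b alg_closure" and p where p: "irreducible p" "degree p > 0" "p dvd c"
      "\<And>a. poly (map_poly to_ac a) \<theta> = 0 \<longleftrightarrow> p dvd a"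
      by (rule ex_residue_root) blast
    define e where "e a = poly (map_poly to_ac a) \<theta>" for a
    interpret e: comm_ring_map e
      unfolding e_def by (rule to_ac.comm_ring_map_poly)
    have e: "e a = 0 \<longleftrightarrow> p dvd a" for a using p(4) by (simp add: e_def)
    obtain c' where c': "c = p * c'" using p(3) by (elim dvdE)
    have p0: "p \<noteq> 0" using p(2) by auto
    have dc': "degree c' < degree c" "c' \<noteq> 0"
      using c' p0 S(1) p(2) by (auto simp: degree_mult_eq)
    \<comment> \<open>Modulo \<open>p\<close> this product is \<open>c f\<close>, which vanishes.
      The reduced coefficients lie in a field, so \<open>p\<close> divides one factor and cancels
      against \<open>c\<close>.\<close>
    have "map_poly e S * map_poly e W = 0"
      unfolding e.map_poly_map_mult[symmetric] S(4)[symmetric] using e[of c] p(3) by simp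
    moreover have content: "\<exists>Y'. Y = smult p Y'" if "map_poly e Y = 0" for Y
    proof -
      have "p dvd coeff Y i" for i
        using arg_cong[OF that, of "\<lambda>Y. coeff Y i"] e by (simp add: coeff_map_poly)
      then have "[:p:] dvd Y" by (simp add: const_poly_dvd_iff)
      then show ?thesis by (auto elim!: dvdE)
    qed
    ultimately consider S' where "S = smult p S'" | W' where "W = smult p W'"
      using content by (metis mult_eq_0_iff)
    then show False
    proof cases
      case 1
      have "smult p (smult c' f - S' * W) = 0"
        using S(4) 1 unfolding c' by (simp add: smult_diff_right)
      then have "smult c' f = S' * W" using p0 by simp
      moreover have "degree S' = degree s" "poly_at S' x = 0" using S 1 p0 by auto
      ultimately have "G c' S'" using dc' by (auto simp: G_def)
      then show False using c_min dc' by fastforce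
    next
      case 2
      have "smult p (smult c' f - S * W') = 0"
        using S(4) 2 unfolding c' by (simp add: smult_diff_right)
      then have "smult c' f = S * W'" using p0 by simp
      then have "G c' S" using S dc' by (auto simp: G_def)
      then show False using c_min dc' by fastforce
    qed
  qed
  have "is_unit c" using \<open>degree c = 0\<close> S(1) by (simp add: is_unit_iff_degree)
  \<comment> \<open>As \<open>f\<close> is monic, the leading coefficients multiply to the unit
    \<open>c\<close>; hence \<open>S\<close> can be rescaled to a monic polynomial.\<close>
  have "lead_coeff S * lead_coeff W = c"
    using arg_cong[OF S(4), of lead_coeff]  assms(1) S(1) by (simp add: lead_coeff_mult)
  then have "is_unit (lead_coeff S)" using \<open>is_unit c\<close> by (metis dvd_mult_left)
  then obtain v where v: "1 = lead_coeff S * v" by (elim dvdE)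
  then have v0: "v \<noteq> 0" using zero_neq_one by fastforce
  define m where "m = smult v S"
  have m1: "lead_coeff m = 1" using v v0 by (simp add: m_def mult.commute)
  have mx: "poly_at m x = 0" using S(3) by (simp add: m_def)
  have md: "degree m = degree s" using v0 S(2) by (simp add: m_def)
  have "degree m > 0"
  proof (rule ccontr)
    assume "\<not> ?thesis"
    then have "m = 1" using m1 by (auto elim!: degree_eq_zeroE)
    then show False using mx by simp
  qed
  have dvd: "m dvd Q" if "poly_at Q x = 0" for Q
  proof -
    obtain W S where Q: "Q = m * W + S" "degree S < degree m"
      using monic_division[OF m1 \<open>degree m > 0\<close>] by blast
    then have "poly_at S x = 0" using that mx by simp
    then have "S = 0" using s_min[of S] Q(2) md by fastforce
    then show ?thesis using Q by simp
  qed
  have "poly_at Q x = 0 \<longleftrightarrow> m dvd Q" for Q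
    using dvd[of Q] mx by (auto elim!: dvdE)
  then show ?thesis by (rule that[OF m1 \<open>degree m > 0\<close>])
qed

text \<open>C_a(x) / x; the coefficient dropped by the shift is zero.\<close>

definition carlitz_quot :: "'a::{finite,field} poly \<Rightarrow> 'a poly poly" where
  "carlitz_quot a = poly_shift 1 (carlitz_poly a)"

lemma carlitz_poly_eq_pCons: "carlitz_poly a = pCons 0 (carlitz_quot a)"
  by (rule poly_eqI) (simp add: carlitz_quot_def coeff_pCons coeff_poly_shift split: nat.splits)

lemma carlitz_eval_eq_quot: "carlitz_eval a x = x * poly_at (carlitz_quot a) x"
  by (simp add: carlitz_eval_eq carlitz_poly_eq_pCons)

lemma coeff_0_carlitz_quot: "coeff (carlitz_quot a) 0 = a"
  using arg_cong[OF pderiv_carlitz_poly[of a], of "\<lambda>p. coeff p 0"]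
  by (simp add: coeff_pderiv carlitz_quot_def coeff_poly_shift)

text \<open>The image of C_a under \<open>h\<close> has the nonzero constant derivative
  \<open>h a\<close>, hence only simple roots. A general \<open>h\<close> covers both the embedding
  into the closure of k and the reductions modulo primes.\<close>

lemma card_roots_carlitz_quot:
  fixes h :: "'a::{finite,field} poly \<Rightarrow> 'c::alg_closed_field"
  assumes "comm_ring_map h" "h a \<noteq> 0" "lead_coeff a = 1"
  shows "card {x. poly (map_poly h (carlitz_quot a)) x = 0} = degree (carlitz_quot a)"
proof -
  interpret h: comm_ring_map h by fact
  let ?f = "map_poly h (carlitz_quot a)"
  have a: "a \<noteq> 0" using assms(3) by auto
  have "carlitz_quot a \<noteq> 0" using a coeff_0_carlitz_quot[of a] by auto
  then have "lead_coeff (carlitz_quot a) = 1"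
    using degree_carlitz_poly(2)[OF a] assms(3) by (simp add: carlitz_poly_eq_pCons one_pCons)
  then have d: "degree ?f = degree (carlitz_quot a)" "?f \<noteq> 0"
    using h.degree_map_poly_monic h.lead_coeff_map_poly_monic by fastforce+
  have "pderiv (pCons 0 ?f) = [:h a:]"
    using arg_cong[OF pderiv_carlitz_poly[of a], of "map_poly h"]
    by (simp add: carlitz_poly_eq_pCons flip: h.pderiv_map_poly_map)
  then have "?f + pCons 0 (pderiv ?f) = [:h a:]" by (simp only: pderiv_pCons)
  \<comment> \<open>The product rule for x times \<open>?f\<close>: at a root of \<open>?f\<close>
    the first summand vanishes, so the derivative cannot.\<close>
  then have *: "poly ?f x + x * poly (pderiv ?f) x = h a" for x
    by (metis poly_add poly_pCons poly_0 mult_zero_right add_0 add_0_right)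
  have "card {x. poly ?f x = 0} = degree ?f"
  proof (rule card_roots_eq_degree[OF d(2)])
    show "poly (pderiv ?f) x \<noteq> 0" if "poly ?f x = 0" for x
      using *[of x] that assms(2) by auto
  qed
  then show ?thesis by (simp add: d(1))
qed

subsection \<open>The conjugates of the generator\<close>

locale carlitz_prime =
  fixes P g :: "'a::{finite,field} poly"
    and lam :: "'a poly fract alg_closure"
  assumes lead_coeff_P: "lead_coeff P = 1" and irreducible_P: "irreducible P"
    and generator: "is_carlitz_generator P lam"
    and primitive_root: "generates_units_mod P g"
begin

abbreviation f :: "'a poly poly" where "f \<equiv> carlitz_quot P"

abbreviation N :: nat where "N \<equiv> degree f"

text \<open>Indexing the conjugates by the exponent of \<open>g\<close> makes \<sigma>_g the shift
  of the index by one.\<close>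

definition conj_lam :: "nat \<Rightarrow> 'a poly fract alg_closure" where
  "conj_lam n = carlitz_eval (g ^ n) lam"

definition R :: "'a poly fract alg_closure set" where
  "R = range (\<lambda>Q. poly_at Q lam)"

lemma P_nonzero [simp]: "P \<noteq> 0"
  using lead_coeff_P by auto

lemma degree_P: "degree P > 0"
  using irreducible_P by (auto simp: irreducible_def is_unit_iff_degree)

lemma f_nonzero [simp]: "f \<noteq> 0"
  using coeff_0_carlitz_quot[of P] by auto

lemma Suc_N: "Suc N = CARD('a) ^ degree P" and lead_coeff_f: "lead_coeff f = 1"
  using degree_carlitz_poly[of P] lead_coeff_P
  by (auto simp: carlitz_poly_eq_pCons one_pCons simp del: coeff_pCons_Suc split: if_splits)
     (metis coeff_pCons_Suc)

lemma N_pos: "N > 0"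
proof -
  have "CARD('a) ^ degree P > 1"
    using degree_P card_field_ge_2[where 'a='a] by (intro one_less_power) auto
  then show ?thesis using Suc_N by simp
qed

lemma root_f_iff: "poly_at f x = 0 \<longleftrightarrow> x \<noteq> 0 \<and> carlitz_eval P x = 0"
  by (auto simp: carlitz_eval_eq_quot poly_0_coeff_0 coeff_map_poly coeff_0_carlitz_quot)

lemma card_roots_f: "card {x. poly_at f x = 0} = N"
  by (rule card_roots_carlitz_quot) (auto simp: lead_coeff_P emb.comm_ring_map_axioms)

lemma torsion_lam: "carlitz_eval P lam = 0"
  using generator by (simp add: is_carlitz_generator_def carlitz_torsion_def)

lemma torsionE:
  assumes "carlitz_eval P x = 0"
  obtains b where "x = carlitz_eval b lam"
  using assms generator by (auto simp: is_carlitz_generator_def carlitz_torsion_def)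

text \<open>If \<open>lam\<close> were 0, all torsion would be 0, but the \<open>N > 0\<close> roots
  of \<open>f\<close> are nonzero torsion points.\<close>

lemma lam_nonzero [simp]: "lam \<noteq> 0"
proof
  assume "lam = 0"
  have "{x. poly_at f x = 0} \<noteq> {}" using card_roots_f N_pos by (metis card.empty less_irrefl)
  then obtain x where "x \<noteq> 0" "carlitz_eval P x = 0" by (auto simp: root_f_iff)
  then show False using \<open>lam = 0\<close> by (auto elim: torsionE)
qed

lemma carlitz_eval_P_mult: "carlitz_eval (P * a) lam = 0"
  by (metis carlitz_eval_mult mult.commute torsion_lam carlitz_eval_at_0)

lemma carlitz_eval_cong:
  assumes "[a = b] (mod P)"
  shows "carlitz_eval a lam = carlitz_eval b lam"
proof -
  have "P dvd a - b" using assms by (simp add: cong_iff_dvd_diff)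
  then obtain c where "a = b + P * c" by (metis dvdE diff_add_cancel add.commute)
  then show ?thesis by (simp add: carlitz_eval_add carlitz_eval_P_mult)
qed

text \<open>\<open>g\<close> has an inverse \<open>u\<close> modulo \<open>P\<close>, and C_{u^n}
  undoes C_{g^n} on \<open>lam\<close>.\<close>

lemma ex_inverse_conj_lam:
  obtains b where "carlitz_eval b (conj_lam n) = lam"
proof -
  have "coprime g P" using primitive_root by (simp add: generates_units_mod_def)
  then obtain u v where "u * g + v * P = 1" using field_poly_bezout by blast
  then have "1 - u * g = v * P" by (simp add: algebra_simps)
  then have "[1 = u * g] (mod P)" by (simp add: cong_iff_dvd_diff)
  then have "[1 ^ n = (u * g) ^ n] (mod P)" by (rule cong_pow)
  then have "carlitz_eval (u ^ n) (conj_lam n) = carlitz_eval 1 lam"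
    using carlitz_eval_cong[of 1 "u ^ n * g ^ n"]
    by (simp add: conj_lam_def power_mult_distrib flip: carlitz_eval_mult)
  then show ?thesis using that by simp
qed

lemma conj_lam_0 [simp]: "conj_lam 0 = lam"
  by (simp add: conj_lam_def)

lemma conj_lam_1: "conj_lam 1 = carlitz_eval g lam"
  by (simp add: conj_lam_def)

lemma conj_lam_add: "conj_lam (m + n) = carlitz_eval (g ^ m) (conj_lam n)"
  by (simp add: conj_lam_def power_add carlitz_eval_mult)

lemma conj_lam_nonzero [simp]: "conj_lam n \<noteq> 0"
  using ex_inverse_conj_lam[of n] lam_nonzero by (metis carlitz_eval_at_0)

text \<open>A nonzero torsion point is C_b(lam) with \<open>b\<close> prime to \<open>P\<close>, and
  such a \<open>b\<close> is congruent to a power of \<open>g\<close>.\<close>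

lemma range_conj_lam: "range conj_lam = {x. poly_at f x = 0}"
proof (intro equalityI subsetI)
  fix x assume "x \<in> range conj_lam"
  then obtain n where x: "x = conj_lam n" by auto
  have "carlitz_eval P x = 0"
    unfolding x conj_lam_def by (simp add: carlitz_eval_P_mult flip: carlitz_eval_mult)
  then show "x \<in> {x. poly_at f x = 0}" by (simp add: root_f_iff x)
next
  fix x assume "x \<in> {x. poly_at f x = 0}"
  then have x: "x \<noteq> 0" "carlitz_eval P x = 0" by (auto simp: root_f_iff)
  then obtain b where b: "x = carlitz_eval b lam" by (auto elim: torsionE)
  have "\<not> P dvd b" using x(1) by (auto simp: b carlitz_eval_P_mult elim!: dvdE)
  then have "coprime b P" using irreducible_P by (rule irreducible_coprime_if_not_dvd[rotated])
  then obtain n where "[b = g ^ n] (mod P)"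
    using primitive_root by (auto simp: generates_units_mod_def)
  then show "x \<in> range conj_lam" by (auto simp: b conj_lam_def dest: carlitz_eval_cong)
qed

lemma poly_at_f_conj_lam [simp]: "poly_at f (conj_lam n) = 0"
  using range_conj_lam by blast

lemma conj_lam_eqD:
  assumes "conj_lam (i + k) = conj_lam i"
  shows "conj_lam k = lam"
proof -
  obtain b where b: "carlitz_eval b (conj_lam i) = lam" by (rule ex_inverse_conj_lam)
  have "conj_lam k = carlitz_eval (g ^ k) (carlitz_eval b (conj_lam i))"
    by (simp only: b) (simp add: conj_lam_def)
  also have "\<dots> = carlitz_eval b (conj_lam (i + k))"
    by (simp add: conj_lam_def power_add mult_ac flip: carlitz_eval_mult)
  finally show ?thesis using assms b by simp
qed

lemma conj_lam_N [simp]: "conj_lam N = lam"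
  and inj_on_conj_lam: "inj_on conj_lam {..<N}"
  and image_conj_lam: "conj_lam ` {..<N} = {x. poly_at f x = 0}"
proof -
  have fin: "finite {x. poly_at f x = 0}" by (intro poly_roots_finite) (auto simp: map_poly_eq_0_iff)
  \<comment> \<open>Pigeonhole: \<open>N + 1\<close> indices meet only \<open>N\<close> roots, which
    yields a period \<open>k \<le> N\<close>. The first \<open>k\<close> indices then reach all
    \<open>N\<close> roots, so \<open>k = N\<close>.\<close>
  have "\<not> inj_on conj_lam {..N}"
  proof
    assume "inj_on conj_lam {..N}"
    then have "card (conj_lam ` {..N}) = Suc N" by (simp add: card_image)
    moreover have "card (conj_lam ` {..N}) \<le> N"
      unfolding card_roots_f[symmetric] using fin range_conj_lam by (intro card_mono) auto
    ultimately show False by simp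
  qed
  then obtain i j where ij: "i < j" "j \<le> N" "conj_lam i = conj_lam j"
    by (auto simp: inj_on_def) (metis linorder_neqE_nat atMost_iff)+
  define k where "k = j - i"
  have k: "0 < k" "k \<le> N" "conj_lam k = lam"
    using ij conj_lam_eqD[of i k] by (auto simp: k_def)
  have per: "conj_lam n = conj_lam (n mod k)" for n
  proof -
    have "conj_lam (m + k * t) = conj_lam m" for m t
    proof (induction t)
      case (Suc t)
      have "conj_lam (m + k * Suc t) = carlitz_eval (g ^ (m + k * t)) (conj_lam k)"
        by (simp add: ac_simps flip: conj_lam_add)
      also have "\<dots> = conj_lam (m + k * t)" unfolding k(3) by (simp add: conj_lam_def)
      finally show ?case using Suc by simp
    qed simp
    from this[of "n mod k" "n div k"] show ?thesis by simp
  qed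
  have "range conj_lam \<subseteq> conj_lam ` {..<k}"
  proof
    fix x assume "x \<in> range conj_lam"
    then obtain n where "x = conj_lam n" by auto
    then show "x \<in> conj_lam ` {..<k}"
      using per[of n] k(1) by (intro image_eqI[of _ _ "n mod k"]) auto
  qed
  then have eq: "conj_lam ` {..<k} = {x. poly_at f x = 0}"
    unfolding range_conj_lam[symmetric] by blast
  have "N \<le> k"
    using card_image_le[of "{..<k}" conj_lam] eq card_roots_f by simp
  then have "k = N" using k(2) by simp
  then show "conj_lam N = lam" "conj_lam ` {..<N} = {x. poly_at f x = 0}" using k eq by auto
  then show "inj_on conj_lam {..<N}"
    using card_roots_f by (intro eq_card_imp_inj_on) auto
qed

lemma conj_lam_add_N: "conj_lam (N + k) = conj_lam k"
  using conj_lam_add[of k N] unfolding conj_lam_N by (simp add: add.commute conj_lam_def[of k])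

text \<open>Moving the window of indices by one trades the factor at \<open>k\<close> for the one at
  \<open>N + k\<close>, and these agree.\<close>

lemma prod_conj_lam_cyclic:
  fixes u :: "'a poly fract alg_closure \<Rightarrow> 'c::comm_monoid_mult"
  shows "(\<Prod>n<N. u (conj_lam (n + k))) = (\<Prod>n<N. u (conj_lam n))"
proof (induction k)
  case (Suc k)
  have "(\<Prod>n<Suc N. u (conj_lam (n + k))) = u (conj_lam k) * (\<Prod>n<N. u (conj_lam (n + Suc k)))"
    by (subst prod.lessThan_Suc_shift) simp
  moreover have "(\<Prod>n<Suc N. u (conj_lam (n + k))) = u (conj_lam (N + k)) * (\<Prod>n<N. u (conj_lam (n + k)))"
    by (simp add: mult.commute)
  ultimately have "(\<Prod>n<N. u (conj_lam (n + Suc k))) = (\<Prod>n<N. u (conj_lam (n + k)))"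
    using prod.lessThan_Suc_shift[of "\<lambda>n. u (conj_lam (n + k))" "N - 1"]
      prod.lessThan_Suc[of "\<lambda>n. u (conj_lam (n + Suc k))" "N - 1"] N_pos conj_lam_add_N[of k]
    by (simp add: mult.commute)
  then show ?case using Suc.IH by simp
qed simp

text \<open>Both sides are monic of degree \<open>N\<close> and agree at the \<open>N\<close>
  distinct conjugates.\<close>

lemma f_split: "map_poly poly_to_ac f = (\<Prod>n<N. [:- conj_lam n, 1:])"
proof (rule poly_eqI_degree_lead_coeff[where n = N and A = "conj_lam ` {..<N}"])
  have d: "degree (\<Prod>n<N. [:- conj_lam n, 1:]) = N"
    by (subst degree_prod_eq_sum_degree) auto
  have l: "lead_coeff (\<Prod>n<N. [:- conj_lam n, 1:]) = 1" by (simp add: lead_coeff_prod)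
  show "coeff (map_poly poly_to_ac f) N = coeff (\<Prod>n<N. [:- conj_lam n, 1:]) N"
    using l d lead_coeff_f by (simp add: coeff_map_poly)
  show "degree (\<Prod>n<N. [:- conj_lam n, 1:]) \<le> N" using d by simp
  show "degree (map_poly poly_to_ac f) \<le> N"
    using emb.degree_map_poly_monic[OF lead_coeff_f] by simp
  show "N \<le> card (conj_lam ` {..<N})" by (simp add: image_conj_lam card_roots_f)
  fix z assume z: "z \<in> conj_lam ` {..<N}"
  then have "poly (\<Prod>n<N. [:- conj_lam n, 1:]) z = 0" unfolding poly_prod by auto
  then show "poly_at f z = poly (\<Prod>n<N. [:- conj_lam n, 1:]) z" using z by auto
qed

lemma P_eq_prod: "poly_to_ac P = (\<Prod>n<N. - conj_lam n)"
  using arg_cong[OF f_split, of "\<lambda>p. poly p 0"]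
  unfolding poly_prod by (simp add: poly_0_coeff_0 coeff_map_poly coeff_0_carlitz_quot)

subsection \<open>The order generated by \<open>\<lambda>\<close> and irreducibility of \<open>f\<close>\<close>

lemma R_intros [intro]:
  "poly_at Q lam \<in> R" "0 \<in> R" "1 \<in> R" "poly_to_ac a \<in> R" "lam \<in> R"
  "x \<in> R \<Longrightarrow> y \<in> R \<Longrightarrow> x + y \<in> R" "x \<in> R \<Longrightarrow> y \<in> R \<Longrightarrow> x - y \<in> R"
  "x \<in> R \<Longrightarrow> - x \<in> R" "x \<in> R \<Longrightarrow> y \<in> R \<Longrightarrow> x * y \<in> R" "x \<in> R \<Longrightarrow> x ^ n \<in> R"
proof -
  show *: "poly_at Q lam \<in> R" for Q by (simp add: R_def)
  show "0 \<in> R" "1 \<in> R" "poly_to_ac a \<in> R" "lam \<in> R"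
    using *[of 0] *[of 1] *[of "[:a:]"] *[of "[:0, 1:]"] by auto
  have R: "x \<in> R \<longleftrightarrow> (\<exists>Q. poly_at Q lam = x)" for x by (auto simp: R_def)
  show "x \<in> R \<Longrightarrow> y \<in> R \<Longrightarrow> x + y \<in> R" unfolding R by (metis emb.map_poly_map_add poly_add)
  show "x \<in> R \<Longrightarrow> y \<in> R \<Longrightarrow> x - y \<in> R" unfolding R by (metis emb.map_poly_map_diff poly_diff)
  show "x \<in> R \<Longrightarrow> - x \<in> R" unfolding R by (metis emb.map_poly_map_minus poly_minus)
  show "x \<in> R \<Longrightarrow> y \<in> R \<Longrightarrow> x * y \<in> R" unfolding R by (metis emb.map_poly_map_mult poly_mult)
  show "x \<in> R \<Longrightarrow> x ^ n \<in> R" unfolding R by (metis emb.map_poly_map_power poly_power)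
qed

lemma R_prod: "(\<And>i. i \<in> I \<Longrightarrow> u i \<in> R) \<Longrightarrow> prod u I \<in> R"
  by (induction I rule: infinite_finite_induct) auto

lemma R_sum: "(\<And>i. i \<in> I \<Longrightarrow> u i \<in> R) \<Longrightarrow> sum u I \<in> R"
  by (induction I rule: infinite_finite_induct) auto

lemma R_E:
  assumes "x \<in> R"
  obtains Q where "x = poly_at Q lam"
  using assms by (auto simp: R_def)

text \<open>Substitution of C_{g^n}(x) lifts the n-th power of \<sigma>_g to A[x], before any
  automorphism has been constructed.\<close>

definition shift :: "nat \<Rightarrow> 'a poly poly \<Rightarrow> 'a poly poly" where
  "shift n Q = pcompose Q (carlitz_poly (g ^ n))"

lemma poly_at_shift: "poly_at (shift n Q) (conj_lam m) = poly_at Q (conj_lam (n + m))"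
  by (simp add: shift_def conj_lam_add carlitz_eval_eq)

lemma poly_at_conj_lam_in_R [intro]: "poly_at Q (conj_lam n) \<in> R"
  using poly_at_shift[of n Q 0] R_intros(1)[of "shift n Q"] by simp

text \<open>Both ratios are polynomial values: C_{g^n}(x)/x at \<open>lam\<close>, and C_b(x)/x at
  \<open>conj_lam n\<close>, where C_b leads back to \<open>lam\<close>.\<close>

lemma conj_lam_associated:
  obtains r s where "r \<in> R" "s \<in> R" "r * s = 1" "conj_lam n = lam * r" "lam = conj_lam n * s"
proof -
  obtain b where b: "carlitz_eval b (conj_lam n) = lam" by (rule ex_inverse_conj_lam)
  define r s where "r = poly_at (carlitz_quot (g ^ n)) lam" and "s = poly_at (carlitz_quot b) (conj_lam n)"
  have "conj_lam n = lam * r" "lam = conj_lam n * s"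
    using b by (simp_all add: r_def s_def conj_lam_def carlitz_eval_eq_quot)
  moreover from this have "r * s = 1"
    by (metis lam_nonzero mult.assoc mult_cancel_left1)
  moreover have "r \<in> R" "s \<in> R" by (auto simp: r_def s_def)
  ultimately show ?thesis using that by blast
qed

text \<open>The claims are proved together: that \<open>P\<close> is no unit is shown with the
  minimal polynomial \<open>m\<close> of \<open>lam\<close>, and this is then used to obtain
  \<open>m = f\<close>.\<close>

lemma
  shows P_not_unit: "x \<in> R \<Longrightarrow> poly_to_ac P * x \<noteq> 1"
    and poly_at_lam_eq_0_iff: "poly_at Q lam = 0 \<longleftrightarrow> f dvd Q"
proof -
  have "poly_at f lam = 0" using poly_at_f_conj_lam[of 0] by simp
  then obtain m where m: "lead_coeff m = 1" "degree m > 0"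
    "\<And>Q. poly_at Q lam = 0 \<longleftrightarrow> m dvd Q"
    by (rule monic_minimal_polynomial[OF lead_coeff_f]) (rule that)
  \<comment> \<open>Modulo \<open>P\<close> the divisibility of \<open>P Q - 1\<close> by
    \<open>m\<close> makes \<open>m\<close> a divisor of -1, but a monic polynomial keeps its
    positive degree under reduction.\<close>
  show P1: "poly_to_ac P * x \<noteq> 1" if xR: "x \<in> R" for x
  proof
    assume eq: "poly_to_ac P * x = 1"
    obtain Q where Q: "x = poly_at Q lam" using xR by (rule R_E)
    then have "poly_at (smult P Q - 1) lam = 0" using eq by simp
    then have "m dvd smult P Q - 1" by (simp only: m(3))
    then obtain W where W: "smult P Q - 1 = m * W" by (rule dvdE)
    obtain \<theta> :: "'a alg_closure" where \<theta>: "\<And>a. poly (map_poly to_ac a) \<theta> = 0 \<longleftrightarrow> P dvd a"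
      using ex_residue_root_irreducible[OF irreducible_P] by blast
    define e where "e a = poly (map_poly to_ac a) \<theta>" for a
    interpret e: comm_ring_map e
      unfolding e_def by (rule to_ac.comm_ring_map_poly)
    have "e P = 0" using \<theta> by (simp add: e_def)
    then have "map_poly e m * map_poly e W = - 1"
      using arg_cong[OF W, of "map_poly e"] by simp
    then have "map_poly e m dvd 1" by (metis dvd_triv_left dvd_minus_iff)
    then have "degree (map_poly e m) = 0"
      by (metis is_unit_iff_degree not_is_unit_0)
    then show False using m e.degree_map_poly_monic by simp
  qed
  \<comment> \<open>The conjugates are associated, so if one were a unit, all would be, and with
    them \<open>P\<close>, the product of their negatives.\<close>
  have lam1: "conj_lam n * x \<noteq> 1" if xR: "x \<in> R" for n x
  proof
    assume eq: "conj_lam n * x = 1"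
    have "\<exists>y\<in>R. (- conj_lam k) * y = 1" for k
    proof -
      obtain r s where rs: "r \<in> R" "s \<in> R" "conj_lam n = lam * r" "lam = conj_lam n * s"
        by (rule conj_lam_associated)
      obtain r' s' where rs': "r' \<in> R" "s' \<in> R" "conj_lam k = lam * r'" "lam = conj_lam k * s'"
        by (rule conj_lam_associated)
      have "(- conj_lam k) * (- (s' * (r * x))) = 1"
        using eq rs(3) rs'(4) by (metis minus_mult_minus mult.assoc)
      moreover have "- (s' * (r * x)) \<in> R" using rs rs' xR by (intro R_intros)
      ultimately show ?thesis by (intro bexI[of _ "- (s' * (r * x))"])
    qed
    then have "\<forall>k. \<exists>y. y \<in> R \<and> (- conj_lam k) * y = 1" by blast
    from choice[OF this] obtain y where y: "y k \<in> R" "(- conj_lam k) * y k = 1" for k by blast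
    have "poly_to_ac P * (\<Prod>n<N. y n) = 1"
      unfolding P_eq_prod prod.distrib[symmetric] using y(2) by simp
    moreover have "(\<Prod>n<N. y n) \<in> R" using y(1) by (rule R_prod)
    ultimately show False using P1 by simp
  qed
  \<comment> \<open>A root of \<open>p\<close> is some \<open>conj_lam n\<close>, and
    \<open>p = c + x p'\<close> shows that it divides the unit \<open>c\<close> in \<open>R\<close>.
    Here \<open>p'\<close> is the quotient by x, not the derivative.\<close>
  have factor: "degree p = 0" if p: "p dvd f" "is_unit (coeff p 0)" for p
  proof (rule ccontr)
    assume "degree p \<noteq> 0"
    then have "degree (map_poly poly_to_ac p) > 0" by (subst degree_map_poly) auto
    then obtain x where x: "poly_at p x = 0" using alg_closed_imp_poly_has_root by blast
    then have "poly_at f x = 0" using p(1) by (auto elim!: dvdE)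
    then have "x \<in> range conj_lam" by (simp add: range_conj_lam)
    then obtain n where n: "x = conj_lam n" by blast
    obtain c p' where p': "p = pCons c p'" by (cases p)
    then obtain d where d: "1 = c * d" using p(2) by (auto elim: dvdE)
    have "poly_to_ac c = - (x * poly_at p' x)" using x unfolding p' by (simp add: eq_neg_iff_add_eq_0)
    moreover have "poly_to_ac c * poly_to_ac d = 1" using d by (metis emb.map_one emb.map_mult)
    ultimately have eq: "conj_lam n * (- (poly_at p' (conj_lam n) * poly_to_ac d)) = 1"
      by (simp add: n mult.assoc)
    have "- (poly_at p' (conj_lam n) * poly_to_ac d) \<in> R" by (intro R_intros poly_at_conj_lam_in_R)
    from lam1[OF this] eq show False by (rule notE)
  qed
  have "m dvd f" using \<open>poly_at f lam = 0\<close> by (simp only: m(3))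
  then obtain W where W: "f = m * W" by (rule dvdE)
  \<comment> \<open>One constant term is a unit because \<open>P\<close> is irreducible. It cannot
    be that of \<open>m\<close>, which has positive degree, so \<open>W\<close> is constant.\<close>
  have "P = coeff m 0 * coeff W 0"
    unfolding coeff_mult_0[symmetric] W[symmetric] by (simp add: coeff_0_carlitz_quot)
  then have "is_unit (coeff m 0) \<or> is_unit (coeff W 0)"
    using irreducible_P by (auto simp: irreducible_def)
  then have "degree W = 0" 
  proof
    assume "is_unit (coeff m 0)"
    then show ?thesis using factor[OF \<open>m dvd f\<close>] m(2) by simp
  next
    assume "is_unit (coeff W 0)"
    then show ?thesis using factor[of W] by (simp add: W)
  qed
  moreover have "lead_coeff W = 1"
    using lead_coeff_mult[of m W] m(1) lead_coeff_f unfolding W[symmetric] by simp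
  ultimately have "W = 1" by (auto elim!: degree_eq_zeroE simp: one_pCons)
  then have "m = f" using W by simp
  then show "poly_at Q lam = 0 \<longleftrightarrow> f dvd Q" by (simp only: m(3))
qed

subsection \<open>Arithmetic of the order\<close>

lemma R_E_reduced:
  assumes "x \<in> R"
  obtains Q where "x = poly_at Q lam" "degree Q < N"
proof -
  obtain Q where Q: "x = poly_at Q lam" using assms by (rule R_E)
  obtain W S where "Q = f * W + S" "degree S < N"
    using monic_division[OF lead_coeff_f N_pos] by blast
  then have "x = poly_at S lam" using Q poly_at_f_conj_lam[of 0] by simp
  then show ?thesis using \<open>degree S < N\<close> by (rule that)
qed

lemma poly_at_lam_inj:
  assumes "poly_at Q lam = poly_at Q' lam" "degree Q < N" "degree Q' < N"
  shows "Q = Q'"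
proof (rule ccontr)
  assume "Q \<noteq> Q'"
  have "poly_at (Q - Q') lam = 0" using assms(1) by simp
  then have "f dvd Q - Q'" by (simp only: poly_at_lam_eq_0_iff)
  then have "N \<le> degree (Q - Q')" using \<open>Q \<noteq> Q'\<close> by (intro dvd_imp_degree_le) auto
  also have "\<dots> < N" using assms(2,3) by (intro le_less_trans[OF degree_diff_le_max]) auto
  finally show False by simp
qed

text \<open>As \<open>f\<close> divides every polynomial vanishing at \<open>lam\<close>, relations
  at \<open>lam\<close> hold at all conjugates. This makes the Galois action on \<open>R\<close>
  well defined.\<close>

lemma poly_at_eq_imp_conj:
  assumes "poly_at Q lam = poly_at Q' lam"
  shows "poly_at Q (conj_lam n) = poly_at Q' (conj_lam n)"
proof -
  have "poly_at (Q - Q') lam = 0" using assms by simp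
  then have "f dvd Q - Q'" by (simp only: poly_at_lam_eq_0_iff)
  then obtain W where W: "Q - Q' = f * W" by (rule dvdE)
  have "poly_at (Q - Q') (conj_lam n) = 0" unfolding W by simp
  then show ?thesis by simp
qed

text \<open>Sending \<open>Q(lam)\<close> to \<open>Q(0)\<close> modulo \<open>P\<close> identifies
  R/lam R with A/P: \<open>f\<close> has constant term \<open>P\<close>, and
  \<open>f(lam) = 0\<close> makes \<open>P\<close> a multiple of \<open>lam\<close>.\<close>

lemma lam_dvd_iff: "(\<exists>y\<in>R. poly_at Q lam = lam * y) \<longleftrightarrow> P dvd coeff Q 0"
proof
  assume "\<exists>y\<in>R. poly_at Q lam = lam * y"
  then obtain Y where "poly_at Q lam = lam * poly_at Y lam" by (auto simp: R_def)
  then have "poly_at (Q - pCons 0 Y) lam = 0" by simp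
  then have "f dvd Q - pCons 0 Y" by (simp only: poly_at_lam_eq_0_iff)
  then obtain W where W: "Q - pCons 0 Y = f * W" by (rule dvdE)
  have "coeff Q 0 = coeff (Q - pCons 0 Y) 0" by simp
  also have "\<dots> = P * coeff W 0" unfolding W by (simp add: coeff_mult_0 coeff_0_carlitz_quot)
  finally show "P dvd coeff Q 0" by simp
next
  assume "P dvd coeff Q 0"
  then obtain k where k: "coeff Q 0 = P * k" by (rule dvdE)
  obtain c Q' where Q': "Q = pCons c Q'" by (cases Q)
  obtain f' where f': "f = pCons P f'"
    by (metis coeff_0_carlitz_quot coeff_pCons_0 pCons_cases)
  have "poly_at (pCons P f') lam = 0" using poly_at_f_conj_lam[of 0] unfolding f' by simp
  then have "poly_to_ac P = lam * (- poly_at f' lam)" by (simp add: eq_neg_iff_add_eq_0)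
  then have "poly_at Q lam = lam * (- poly_at f' lam * poly_to_ac k + poly_at Q' lam)"
    using k by (simp add: Q' algebra_simps)
  moreover have "- poly_at f' lam * poly_to_ac k + poly_at Q' lam \<in> R" by (intro R_intros)
  ultimately show "\<exists>y\<in>R. poly_at Q lam = lam * y" by blast
qed

text \<open>R/lam R is the field A/P and has no nonzero nilpotent elements.\<close>

lemma lam_dvd_power:
  assumes "x \<in> R" "y \<in> R" "x ^ n = lam * y"
  obtains z where "z \<in> R" "x = lam * z"
proof -
  obtain Q where Q: "x = poly_at Q lam" using assms(1) by (rule R_E)
  have "poly_at (Q ^ n) lam = lam * y" using assms(3) by (simp add: Q)
  then have "P dvd coeff (Q ^ n) 0" using lam_dvd_iff assms(2) by blast
  then have "P dvd coeff Q 0"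
    unfolding coeff_0_power by (rule irreducible_dvd_power[OF irreducible_P])
  then have "\<exists>z\<in>R. x = lam * z" unfolding Q by (simp only: lam_dvd_iff)
  then show ?thesis using that by blast
qed

text \<open>\<open>R/pR\<close> is reduced because the reduction of \<open>f\<close> modulo \<open>p\<close> has no multiple roots.\<close>

lemma unramified_dvd_power:
  assumes p: "irreducible p" "\<not> p dvd P" and x: "x \<in> R" "y \<in> R" "x ^ n = poly_to_ac p * y"
  obtains z where "z \<in> R" "x = poly_to_ac p * z"
proof -
  obtain Q where Q: "x = poly_at Q lam" "degree Q < N" using x(1) by (rule R_E_reduced)
  obtain Y where Y: "y = poly_at Y lam" using x(2) by (rule R_E)
  have "poly_at (Q ^ n - smult p Y) lam = 0" using x(3) by (simp add: Q Y)
  then have "f dvd Q ^ n - smult p Y" by (simp only: poly_at_lam_eq_0_iff)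
  then obtain W where W: "Q ^ n - smult p Y = f * W" by (rule dvdE)
  obtain \<theta> :: "'a alg_closure" where \<theta>: "\<And>a. poly (map_poly to_ac a) \<theta> = 0 \<longleftrightarrow> p dvd a"
    using ex_residue_root_irreducible[OF p(1)] by blast
  define e where "e a = poly (map_poly to_ac a) \<theta>" for a
  interpret e: comm_ring_map e
    unfolding e_def by (rule to_ac.comm_ring_map_poly)
  have e: "e a = 0 \<longleftrightarrow> p dvd a" for a using \<theta> by (simp add: e_def)
  have ep: "e p = 0" by (simp add: e)
  have card: "card {r. poly (map_poly e f) r = 0} = N"
    using p(2) lead_coeff_P by (intro card_roots_carlitz_quot e.comm_ring_map_axioms) (simp_all add: e)
  have roots: "poly (map_poly e Q) r = 0" if "poly (map_poly e f) r = 0" for r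
  proof -
    have "poly (map_poly e (Q ^ n - smult p Y)) r = 0" unfolding W using that by simp
    then show ?thesis using ep by simp
  qed
  \<comment> \<open>The reduction of \<open>Q\<close> vanishes at the \<open>N\<close> distinct
    roots of the reduction of \<open>f\<close>, but its degree is below \<open>N\<close>.\<close>
  have "map_poly e Q = 0"
  proof (rule ccontr)
    assume nz: "map_poly e Q \<noteq> 0"
    have "N \<le> card {r. poly (map_poly e Q) r = 0}"
      unfolding card[symmetric] using roots nz by (intro card_mono poly_roots_finite) auto
    also have "\<dots> \<le> degree (map_poly e Q)" using nz by (rule card_poly_roots_bound)
    also have "\<dots> \<le> degree Q" by (rule degree_le) (auto simp: coeff_map_poly coeff_eq_0)
    finally show False using Q(2) by simp
  qed
  then have "e (coeff Q i) = 0" for i by (metis coeff_map_poly e.map_zero coeff_0)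
  then have "[:p:] dvd Q" by (simp add: const_poly_dvd_iff e)
  then obtain Q' where "Q = [:p:] * Q'" by (rule dvdE)
  then have "x = poly_to_ac p * poly_at Q' lam" by (simp add: Q(1))
  then show ?thesis by (rule that[rotated]) (rule R_intros)
qed

section \<open>The unit group of \<open>R\<close> and the ramification of \<open>P\<close>\<close>

lemma units_R_mult:
  assumes "x \<in> units_in R" "y \<in> units_in R"
  shows "x * y \<in> units_in R"
  using units_inD[OF assms(1)] units_inD[OF assms(2)]
  by (intro units_inI) (simp_all add: R_intros)

lemma units_R_inverse: "x \<in> units_in R \<Longrightarrow> inverse x \<in> units_in R"
  using units_inD[of x R] by (intro units_inI) simp_all

lemma units_R_divide: "x \<in> units_in R \<Longrightarrow> y \<in> units_in R \<Longrightarrow> x / y \<in> units_in R"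
  by (simp add: divide_inverse units_R_mult units_R_inverse)

lemma units_R_1: "1 \<in> units_in R"
  by (intro units_inI) (simp_all add: R_intros)

lemma units_R_minus: "x \<in> units_in R \<Longrightarrow> - x \<in> units_in R"
  using units_inD[of x R] by (intro units_inI) (simp_all add: R_intros)

lemma units_R_prod: "(\<And>i. i \<in> I \<Longrightarrow> u i \<in> units_in R) \<Longrightarrow> prod u I \<in> units_in R"
  by (induction I rule: infinite_finite_induct) (simp_all add: units_R_1 units_R_mult)

lemma units_R_power: "x \<in> units_in R \<Longrightarrow> x ^ n \<in> units_in R"
  by (induction n) (simp_all add: units_R_1 units_R_mult)

lemma units_R_factor:
  assumes "x \<in> R" "y \<in> R" "x * y \<in> units_in R"
  shows "x \<in> units_in R"
proof -
  have *: "x \<noteq> 0" "y \<noteq> 0" "inverse (x * y) \<in> R" using units_inD[OF assms(3)] by auto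
  then have eq: "inverse x = y * inverse (x * y)" by (simp add: field_simps)
  have "inverse x \<in> R" unfolding eq using assms(2) *(3) by (rule R_intros)
  with assms(1) show ?thesis using *(1) by (rule units_inI)
qed

lemma conj_lam_div_unit: "conj_lam n / lam \<in> units_in R"
proof -
  obtain r s where rs: "r \<in> R" "s \<in> R" "r * s = 1" "conj_lam n = lam * r" "lam = conj_lam n * s"
    by (rule conj_lam_associated)
  then have "conj_lam n / lam = r" by simp
  then show ?thesis using rs by (auto simp: units_in_def)
qed

text \<open>Total ramification: up to sign \<open>P\<close> is the product of \<open>N\<close>
  conjugates, each a unit times \<open>lam\<close>.\<close>

lemma P_div_unit: "poly_to_ac P / lam ^ N \<in> units_in R"
proof -
  have "poly_to_ac P / lam ^ N = (\<Prod>n<N. - (conj_lam n / lam))"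
    by (simp add: P_eq_prod prod_dividef flip: divide_minus_left)
  then show ?thesis by (simp only: units_R_prod units_R_minus conj_lam_div_unit)
qed

lemma lam_not_unit: "lam \<notin> units_in R"
proof
  assume "lam \<in> units_in R"
  then have "poly_to_ac P / lam ^ N * lam ^ N \<in> units_in R"
    by (intro units_R_mult P_div_unit units_R_power)
  then have "poly_to_ac P \<in> units_in R" by simp
  then show False using P_not_unit by (auto simp: units_in_def)
qed

section \<open>Fixed elements, characteristic polynomials and norms\<close>

lemma fixed_in_base:
  assumes "poly_at Q (conj_lam 1) = poly_at Q lam"
  shows "poly_at Q lam \<in> range poly_to_ac"
proof -
  have "poly_at (shift 1 Q) lam = poly_at Q lam"
    using assms poly_at_shift[of 1 Q 0] by simp
  then have step: "poly_at Q (conj_lam (Suc n)) = poly_at Q (conj_lam n)" for n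
    using poly_at_eq_imp_conj[of "shift 1 Q" Q n] poly_at_shift[of 1 Q n] by simp
  have const: "poly_at Q (conj_lam n) = poly_at Q lam" for n
    by (induction n) (simp_all add: step)
  obtain S where S: "poly_at Q lam = poly_at S lam" "degree S < N"
    by (rule R_E_reduced[OF R_intros(1)])
  \<comment> \<open>The reduced representative \<open>S\<close> takes one value at \<open>N\<close>
    distinct points and has degree below \<open>N\<close>, so it is constant and the value lies in
    A.\<close>
  have "map_poly poly_to_ac S = [:poly_at Q lam:]"
  proof (rule poly_eqI_degree[where A = "conj_lam ` {..<N}"])
    have card: "card (conj_lam ` {..<N}) = N" using inj_on_conj_lam by (simp add: card_image)
    show "degree (map_poly poly_to_ac S) < card (conj_lam ` {..<N})"
      "degree [:poly_at Q lam:] < card (conj_lam ` {..<N})"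
      using S(2) by (simp_all add: card degree_map_poly)
    fix z assume "z \<in> conj_lam ` {..<N}"
    then obtain n where "z = conj_lam n" by blast
    then show "poly_at S z = poly [:poly_at Q lam:] z"
      using poly_at_eq_imp_conj[OF S(1), of n] const[of n] by simp
  qed
  from arg_cong[OF this, of "\<lambda>p. coeff p 0"] have "poly_at Q lam = poly_to_ac (coeff S 0)"
    by (simp add: coeff_map_poly)
  then show ?thesis by (rule range_eqI)
qed

text \<open>The coefficients of the product are invariant under the index shift, hence lie in
  A.\<close>

lemma charpoly_exists:
  obtains p where "lead_coeff p = 1"
    "map_poly poly_to_ac p = (\<Prod>n<N. [:- poly_at Q (conj_lam n), 1:])"
proof -
  \<comment> \<open>A lift of the product with coefficients in A[x], so that the criterion for fixed
    values of polynomials applies to each coefficient.\<close>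
  define W where "W = (\<Prod>n<N. [:- shift n Q, 1:])"
  let ?F = "\<Prod>n<N. [:- poly_at Q (conj_lam n), 1:]"
  have W: "poly_at (coeff W i) (conj_lam m) = coeff ?F i" for i m
  proof -
    interpret ev: comm_ring_map "\<lambda>S. poly_at S (conj_lam m)"
      by (rule emb.comm_ring_map_poly)
    have "map_poly (\<lambda>S. poly_at S (conj_lam m)) W = (\<Prod>n<N. [:- poly_at Q (conj_lam (n + m)), 1:])"
      unfolding W_def ev.map_poly_map_prod by (simp add: poly_at_shift)
    also have "\<dots> = ?F"
      by (rule prod_conj_lam_cyclic[where u = "\<lambda>z. [:- poly_at Q z, 1:]"])
    finally show ?thesis by (metis coeff_map_poly ev.map_zero)
  qed
  have "coeff ?F i \<in> range poly_to_ac" for i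
    using fixed_in_base[of "coeff W i"] W[of i 0] W[of i 1] by simp
  then obtain p where p: "map_poly poly_to_ac p = ?F"
    using ex_map_poly_eq[of ?F poly_to_ac] by auto
  have "lead_coeff ?F = 1" by (simp add: lead_coeff_prod)
  then have "lead_coeff (map_poly poly_to_ac p) = 1" using p by simp
  then have "poly_to_ac (lead_coeff p) = poly_to_ac 1"
    by (simp add: degree_map_poly coeff_map_poly)
  then show ?thesis using p by (intro that[of p]) (simp_all only: poly_to_ac_eq_iff)
qed

lemma norm_exists:
  obtains a where "poly_to_ac a = (\<Prod>n<N. poly_at Q (conj_lam n))"
proof -
  \<comment> \<open>With \<open>- Q\<close> the constant term of the characteristic polynomial is
    the norm of \<open>Q\<close> without a sign.\<close>
  obtain p where p: "map_poly poly_to_ac p = (\<Prod>n<N. [:- poly_at (- Q) (conj_lam n), 1:])"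
    by (rule charpoly_exists[of "- Q"])
  have "poly_to_ac (coeff p 0) = poly (map_poly poly_to_ac p) 0"
    by (simp add: poly_0_coeff_0 coeff_map_poly)
  also have "\<dots> = (\<Prod>n<N. poly_at Q (conj_lam n))" unfolding p poly_prod by simp
  finally show ?thesis by (rule that)
qed

lemma R_integral: "x \<in> R \<Longrightarrow> \<exists>p :: 'a poly poly. lead_coeff p = 1 \<and> poly_at p x = 0"
proof -
  assume "x \<in> R"
  then obtain Q where Q: "x = poly_at Q lam" by (rule R_E)
  obtain p where p: "lead_coeff p = 1"
    "map_poly poly_to_ac p = (\<Prod>n<N. [:- poly_at Q (conj_lam n), 1:])" by (rule charpoly_exists)
  have "\<exists>n\<in>{..<N}. poly [:- poly_at Q (conj_lam n), 1:] x = 0"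
    using N_pos Q by (intro bexI[of _ 0]) auto
  then have "poly_at p x = 0" unfolding p(2) poly_prod by simp
  then show ?thesis using p(1) by blast
qed

subsection \<open>The order is integrally closed\<close>

abbreviation K :: "'a poly fract alg_closure set" where "K \<equiv> carlitz_field lam"

lemma poly_at_conj_lam_eq_0_iff: "poly_at Q (conj_lam n) = 0 \<longleftrightarrow> poly_at Q lam = 0"
proof
  assume "poly_at Q (conj_lam n) = 0"
  then have "poly_at (shift n Q) lam = poly_at 0 lam" using poly_at_shift[of n Q 0] by simp
  \<comment> \<open>The shift by \<open>n\<close> lands at the index \<open>n * N\<close>, where the
    conjugate is \<open>lam\<close> again; \<open>N > 0\<close> keeps the subtraction from
    truncating.\<close>
  then have "poly_at (shift n Q) (conj_lam (n * N - n)) = 0"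
    using poly_at_eq_imp_conj[of "shift n Q" 0] by simp
  moreover have "conj_lam (n * N) = lam"
    by (induction n) (simp_all add: conj_lam_add_N)
  ultimately show "poly_at Q lam = 0" using N_pos by (simp add: poly_at_shift)
next
  assume "poly_at Q lam = 0"
  then show "poly_at Q (conj_lam n) = 0" using poly_at_eq_imp_conj[of Q 0 n] by simp
qed

text \<open>The cofactor is the product of the other conjugates, and the norm is nonzero.\<close>

lemma R_divides_base:
  assumes "x \<in> R" "x \<noteq> 0"
  obtains a y where "a \<noteq> 0" "y \<in> R" "x * y = poly_to_ac a"
proof -
  obtain Q where Q: "x = poly_at Q lam" using assms(1) by (rule R_E)
  obtain a where a: "poly_to_ac a = (\<Prod>n<N. poly_at Q (conj_lam n))" by (rule norm_exists)
  have "poly_to_ac a \<noteq> 0"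
    using assms(2) by (simp add: a Q poly_at_conj_lam_eq_0_iff)
  moreover have "poly_to_ac a = x * (\<Prod>n\<in>{..<N} - {0}. poly_at Q (conj_lam n))"
    unfolding a Q using N_pos by (subst prod.remove[of _ 0]) auto
  moreover have "(\<Prod>n\<in>{..<N} - {0}. poly_at Q (conj_lam n)) \<in> R"
    by (intro R_prod poly_at_conj_lam_in_R)
  ultimately show ?thesis by (metis that emb.map_zero)
qed

text \<open>Denominators from A suffice: each nonzero element of \<open>R\<close> divides a nonzero
  element of A, which gives closure under inverses.\<close>

lemma K_eq: "K = {x. \<exists>D. D \<noteq> 0 \<and> poly_to_ac D * x \<in> R}"
  and R_subset_K: "R \<subseteq> K"
proof -
  define E where "E = {x. \<exists>D. D \<noteq> 0 \<and> poly_to_ac D * x \<in> R}"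
  have sub: "is_subfield K" unfolding carlitz_field_def by (rule is_subfield_adjoin)
  note K = is_subfieldD[OF sub]
  have base: "base_field \<subseteq> K" "lam \<in> K"
    using adjoin_superset[of lam base_field] by (auto simp: carlitz_field_def)
  then have emb: "poly_to_ac a \<in> K" for a by (auto simp: base_field_def poly_to_ac_def)
  have "poly_at Q lam \<in> K" for Q
    by (induction Q) (simp_all add: K base emb)
  then show RK: "R \<subseteq> K" by (auto simp: R_def)
  have "E \<subseteq> K"
  proof
    fix x assume "x \<in> E"
    then obtain D where D: "D \<noteq> 0" "poly_to_ac D * x \<in> K" using RK by (auto simp: E_def)
    have "inverse (poly_to_ac D) * (poly_to_ac D * x) \<in> K" by (intro K emb D)
    then show "x \<in> K" using D(1) by (simp add: mult.assoc[symmetric])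
  qed
  moreover have "is_subfield E"
    unfolding is_subfield_def
  proof (intro conjI ballI)
    have "poly_to_ac 1 * 1 \<in> R" by (simp add: R_intros)
    then show "1 \<in> E" unfolding E_def using one_neq_zero by blast
  next
    fix x y assume "x \<in> E" "y \<in> E"
    then obtain D D' where D: "D \<noteq> 0" "poly_to_ac D * x \<in> R" "D' \<noteq> 0" "poly_to_ac D' * y \<in> R"
      by (auto simp: E_def)
    have "poly_to_ac D' * (poly_to_ac D * x) - poly_to_ac D * (poly_to_ac D' * y) \<in> R"
      "(poly_to_ac D * x) * (poly_to_ac D' * y) \<in> R" using D by (simp_all only: R_intros)
    then have "poly_to_ac (D * D') * (x - y) \<in> R" "poly_to_ac (D * D') * (x * y) \<in> R"
      by (simp_all add: algebra_simps)
    moreover have "D * D' \<noteq> 0" using D by simp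
    ultimately show "x - y \<in> E" "x * y \<in> E" unfolding E_def by blast+
  next
    fix x assume "x \<in> E"
    then obtain D where D: "D \<noteq> 0" "poly_to_ac D * x \<in> R" by (auto simp: E_def)
    show "inverse x \<in> E"
    proof (cases "x = 0")
      case False
      then obtain a y where a: "a \<noteq> 0" "y \<in> R" "poly_to_ac D * x * y = poly_to_ac a"
        using R_divides_base[OF D(2)] D(1) by auto
      have "poly_to_ac a * inverse x = poly_to_ac D * y"
        unfolding a(3)[symmetric] using False by (simp add: field_simps)
      moreover have "poly_to_ac D * y \<in> R" using a(2) by (intro R_intros)
      ultimately show ?thesis unfolding E_def using a(1) by auto
    qed (use \<open>x \<in> E\<close> in simp)
  qed
  moreover have "insert lam base_field \<subseteq> E"
  proof
    fix x assume "x \<in> insert lam base_field"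
    then consider "x = lam" | z where "x = to_ac z" by (auto simp: base_field_def)
    then show "x \<in> E"
    proof cases
      case 1
      then have "poly_to_ac 1 * x \<in> R" by (simp add: R_intros)
      then show ?thesis unfolding E_def using one_neq_zero by blast
    next
      case 2
      obtain a b where "b \<noteq> 0" "poly_to_ac b * to_ac z = poly_to_ac a" by (rule to_ac_eq_quotient)
      then have "b \<noteq> 0 \<and> poly_to_ac b * x \<in> R" using 2 by (simp add: R_intros)
      then show ?thesis unfolding E_def by blast
    qed
  qed
  ultimately have "K = E" using adjoin_minimal[of E lam base_field] by (auto simp: carlitz_field_def)
  then show "K = {x. \<exists>D. D \<noteq> 0 \<and> poly_to_ac D * x \<in> R}" by (simp add: E_def)
qed

lemma K_E:
  assumes "x \<in> K"
  obtains D Q where "D \<noteq> 0" "poly_to_ac D * x = poly_at Q lam"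
proof -
  obtain D where D: "D \<noteq> 0" "poly_to_ac D * x \<in> R" using assms K_eq by auto
  obtain Q where "poly_to_ac D * x = poly_at Q lam" using D(2) by (rule R_E)
  with D(1) show ?thesis by (rule that)
qed

lemma K_I:
  assumes "D \<noteq> 0" "poly_to_ac D * x \<in> R"
  shows "x \<in> K"
  using assms unfolding K_eq by blast

text \<open>The equation of integral dependence of \<open>x\<close>, multiplied by \<open>\<delta>\<^sup>n\<close>.\<close>

lemma integral_dvd_power:
  fixes p :: "'a poly poly"
  assumes p: "lead_coeff p = 1" "poly_at p x = 0" and d: "\<delta> \<in> R" "\<delta> * x \<in> R"
  obtains n y where "y \<in> R" "(\<delta> * x) ^ n = \<delta> * y"
proof -
  define n where "n = degree p"
  define y where "y = - (\<Sum>i<n. poly_to_ac (coeff p i) * \<delta> ^ (n - Suc i) * (\<delta> * x) ^ i)"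
  have "0 = (\<Sum>i\<le>n. poly_to_ac (coeff p i) * x ^ i)"
    using p(2) emb.degree_map_poly_monic[OF p(1)] by (simp add: poly_altdef coeff_map_poly n_def)
  also have "\<dots> = (\<Sum>i<n. poly_to_ac (coeff p i) * x ^ i) + x ^ n"
    using p(1) by (simp add: n_def flip: lessThan_Suc_atMost)
  finally have "x ^ n = - (\<Sum>i<n. poly_to_ac (coeff p i) * x ^ i)"
    by (simp add: eq_neg_iff_add_eq_0 add.commute)
  then have "(\<delta> * x) ^ n = - (\<Sum>i<n. \<delta> ^ n * (poly_to_ac (coeff p i) * x ^ i))"
    by (simp add: power_mult_distrib sum_distrib_left)
  also have "(\<Sum>i<n. \<delta> ^ n * (poly_to_ac (coeff p i) * x ^ i)) =
      (\<Sum>i<n. \<delta> * (poly_to_ac (coeff p i) * \<delta> ^ (n - Suc i) * (\<delta> * x) ^ i))"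
  proof (rule sum.cong)
    fix i assume "i \<in> {..<n}"
    then have "n = Suc (n - Suc i) + i" by auto
    then have "\<delta> ^ n = \<delta> * \<delta> ^ (n - Suc i) * \<delta> ^ i" by (metis power_add power_Suc)
    then show "\<delta> ^ n * (poly_to_ac (coeff p i) * x ^ i) =
        \<delta> * (poly_to_ac (coeff p i) * \<delta> ^ (n - Suc i) * (\<delta> * x) ^ i)"
      by (simp add: power_mult_distrib mult_ac)
  qed simp
  finally have "(\<delta> * x) ^ n = \<delta> * y" by (simp add: y_def sum_distrib_left)
  moreover have "y \<in> R" unfolding y_def using d by (intro R_intros(8) R_sum) (simp only: R_intros)
  ultimately show ?thesis using that by blast
qed

text \<open>For \<delta> = lam^(j+1) w, integrality makes a power of \<delta> x a multiple of
  \<delta>, hence of \<open>lam\<close>. Then \<open>lam\<close> divides \<delta> x itself and can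
  be cancelled.\<close>

lemma integral_lam_power:
  fixes p :: "'a poly poly"
  assumes p: "lead_coeff p = 1" "poly_at p x = 0" and w: "w \<in> R" "lam ^ j * w * x \<in> R"
  shows "w * x \<in> R"
  using w(2)
proof (induction j)
  case (Suc j)
  have "lam ^ Suc j * w \<in> R" using w(1) by (intro R_intros)
  then obtain n y where y: "y \<in> R" "(lam ^ Suc j * w * x) ^ n = lam ^ Suc j * w * y"
    using integral_dvd_power[OF p] Suc.prems by blast
  have "lam ^ j * w * y \<in> R" using w(1) y(1) by (intro R_intros)
  moreover have "(lam ^ Suc j * w * x) ^ n = lam * (lam ^ j * w * y)" unfolding y(2) by simp
  ultimately obtain z where z: "z \<in> R" "lam ^ Suc j * w * x = lam * z"
    using lam_dvd_power[OF Suc.prems] by blast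
  then have "lam ^ j * w * x = z" by (simp add: mult.assoc)
  then show ?case using Suc.IH z(1) by simp
qed simp

text \<open>Prime factors of the denominator are removed by induction on its degree. A factor
  \<open>P\<close> is exchanged for a unit times \<open>lam^N\<close>, whose powers of
  \<open>lam\<close> cancel; any other prime cancels because \<open>R\<close> is reduced modulo
  it.\<close>

lemma integral_in_R:
  fixes p :: "'a poly poly"
  assumes p: "lead_coeff p = 1" "poly_at p x = 0" and D: "D \<noteq> 0" "poly_to_ac D * x \<in> R"
  shows "x \<in> R"
  using D
proof (induction "degree D" arbitrary: D rule: less_induct)
  case less
  show ?case
  proof (cases "degree D = 0")
    case True
    then have "is_unit D" using less.prems(1) by (simp add: is_unit_iff_degree)
    then obtain d where "1 = D * d" by (rule dvdE)
    then have "poly_to_ac d * (poly_to_ac D * x) = x"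
      by (metis emb.map_mult emb.map_one mult.assoc mult.commute mult_1)
    then show ?thesis using R_intros(9)[OF R_intros(4) less.prems(2), of d] by (simp only:)
  next
    case False
    then have "degree D > 0" by simp
    then obtain \<theta> :: "'a alg_closure" and r where r: "irreducible r" "degree r > 0" "r dvd D"
      "\<And>a. poly (map_poly to_ac a) \<theta> = 0 \<longleftrightarrow> r dvd a"
      by (rule ex_residue_root) (rule that)
    have smaller: "degree D' < degree D \<and> D' \<noteq> 0" if "D = s * D'" "degree s > 0" for s D'
      using that less.prems(1) by (auto simp: degree_mult_eq)
    show ?thesis
    proof (cases "r dvd P")
      case True
      then have "P dvd D"
        using irreducible_dvd_irreducible[OF r(1) irreducible_P] r(3) dvd_trans by blast
      then obtain D' where D': "D = P * D'" by (rule dvdE)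
      have inv: "inverse (poly_to_ac P / lam ^ N) \<in> R" using units_inD(2)[OF P_div_unit] .
      have "inverse (poly_to_ac P / lam ^ N) * (poly_to_ac D * x) = lam ^ N * poly_to_ac D' * x"
        by (simp add: D')
      then have "lam ^ N * poly_to_ac D' * x \<in> R"
        using R_intros(9)[OF inv less.prems(2)] by (simp only:)
      then have "poly_to_ac D' * x \<in> R"
        by (rule integral_lam_power[OF p R_intros(4)])
      then show ?thesis using less.hyps smaller[OF D' degree_P] by blast
    next
      case False
      obtain D' where D': "D = r * D'" using r(3) by (rule dvdE)
      obtain n y where y: "y \<in> R" "(poly_to_ac D * x) ^ n = poly_to_ac D * y"
        by (rule integral_dvd_power[OF p R_intros(4) less.prems(2)])
      have "poly_to_ac D' * y \<in> R" using y(1) by (intro R_intros)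
      moreover have "(poly_to_ac D * x) ^ n = poly_to_ac r * (poly_to_ac D' * y)"
        unfolding y(2) by (simp add: D')
      ultimately obtain z where z: "z \<in> R" "poly_to_ac D * x = poly_to_ac r * z"
        using unramified_dvd_power[OF r(1) False less.prems(2)] by blast
      then have "poly_to_ac D' * x = z" using r(2) by (auto simp: D')
      then show ?thesis using less.hyps smaller[OF D' r(2)] z(1) by blast
    qed
  qed
qed

lemma carlitz_integers_eq: "carlitz_integers lam = R"
proof (intro equalityI subsetI)
  fix x assume "x \<in> carlitz_integers lam"
  then obtain p :: "'a poly poly" where x: "x \<in> K" "lead_coeff p = 1" "poly_at p x = 0"
    by (auto simp: carlitz_integers_def integral_closure_def)
  obtain D where "D \<noteq> 0" "poly_to_ac D * x \<in> R" using x(1) unfolding K_eq by blast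
  then show "x \<in> R" by (rule integral_in_R[OF x(2,3)])
next
  fix x assume "x \<in> R"
  then show "x \<in> carlitz_integers lam"
    using R_integral[of x] R_subset_K by (auto simp: carlitz_integers_def integral_closure_def)
qed

subsection \<open>The Galois group\<close>

abbreviation G :: "('a poly fract alg_closure \<Rightarrow> 'a poly fract alg_closure) set" where
  "G \<equiv> galois_group K base_field"

lemma emb_in_base: "poly_to_ac a \<in> base_field"
  by (simp add: base_field_def poly_to_ac_def)

lemma galois_poly_at:
  assumes "\<tau> \<in> G"
  shows "\<tau> (poly_at Q lam) = poly_at Q (\<tau> lam)"
proof -
  have t: "\<And>x y. x \<in> K \<Longrightarrow> y \<in> K \<Longrightarrow> \<tau> (x + y) = \<tau> x + \<tau> y"
    "\<And>x y. x \<in> K \<Longrightarrow> y \<in> K \<Longrightarrow> \<tau> (x * y) = \<tau> x * \<tau> y" "\<And>a. \<tau> (poly_to_ac a) = poly_to_ac a"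
    using assms emb_in_base by (auto simp: galois_group_def)
  have K: "x \<in> K" if "x \<in> R" for x using that R_subset_K by blast
  show ?thesis
  proof (induction Q)
    case 0
    then show ?case using t(3)[of 0] by simp
  next
    case (pCons c Q)
    have "lam * poly_at Q lam \<in> K" "lam \<in> K" "poly_at Q lam \<in> K" "poly_to_ac c \<in> K"
      by (intro K R_intros)+
    then show ?case using pCons.IH by (simp add: t)
  qed
qed

lemma galois_eq_quotient:
  assumes "\<tau> \<in> G" "D \<noteq> 0" "poly_to_ac D * x = poly_at Q lam"
  shows "\<tau> x = poly_at Q (\<tau> lam) / poly_to_ac D"
proof -
  have x: "x \<in> K" by (rule K_I[OF assms(2)]) (simp only: assms(3) R_intros)
  have "poly_to_ac D \<in> K" using R_subset_K R_intros(4) by blast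
  then have "\<tau> (poly_to_ac D * x) = \<tau> (poly_to_ac D) * \<tau> x"
    using assms(1) x by (simp add: galois_group_def)
  moreover have "\<tau> (poly_to_ac D) = poly_to_ac D"
    using assms(1) emb_in_base by (auto simp: galois_group_def)
  ultimately have "poly_to_ac D * \<tau> x = poly_at Q (\<tau> lam)"
    using galois_poly_at[OF assms(1), of Q] assms(3) by simp
  then show ?thesis using assms(2) by (simp add: field_simps)
qed

text \<open>The automorphism sends \<open>Q(lam)/D\<close> to \<open>Q(conj_lam n)/D\<close>, which
  is well defined because relations at \<open>lam\<close> carry over to conjugates.\<close>

lemma ex_galois_conj:
  obtains \<tau> where "\<tau> \<in> G" "\<tau> lam = conj_lam n"
proof -
  have wd: "poly_to_ac D' * poly_at Q (conj_lam n) = poly_to_ac D * poly_at Q' (conj_lam n)"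
    if "poly_to_ac D * x = poly_at Q lam" "poly_to_ac D' * x = poly_at Q' lam" for D D' Q Q' x
  proof -
    have "poly_at (smult D' Q) lam = poly_at (smult D Q') lam"
      using that by (simp flip: that)
    from poly_at_eq_imp_conj[OF this, of n] show ?thesis by simp
  qed
  \<comment> \<open>Asking for the equation for all representations of \<open>x\<close> at once lets
    sums and products be computed later with any convenient denominator.\<close>
  have "\<exists>y. \<forall>D Q. poly_to_ac D * x = poly_at Q lam \<longrightarrow> poly_to_ac D * y = poly_at Q (conj_lam n)"
    if "x \<in> K" for x
  proof -
    obtain D' Q' where D': "D' \<noteq> 0" "poly_to_ac D' * x = poly_at Q' lam" using \<open>x \<in> K\<close> by (rule K_E)
    show ?thesis
    proof (intro exI[of _ "poly_at Q' (conj_lam n) / poly_to_ac D'"] allI impI)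
      fix D Q assume "poly_to_ac D * x = poly_at Q lam"
      from wd[OF this D'(2)] D'(1)
      show "poly_to_ac D * (poly_at Q' (conj_lam n) / poly_to_ac D') = poly_at Q (conj_lam n)"
        by (simp add: field_simps)
    qed
  qed
  then have "\<forall>x\<in>K. \<exists>y. \<forall>D Q. poly_to_ac D * x = poly_at Q lam \<longrightarrow>
      poly_to_ac D * y = poly_at Q (conj_lam n)" by blast
  from bchoice[OF this] obtain \<phi> where \<phi>: "poly_to_ac D * \<phi> x = poly_at Q (conj_lam n)"
    if "x \<in> K" "poly_to_ac D * x = poly_at Q lam" for x D Q by blast
  have sub: "is_subfield K" unfolding carlitz_field_def by (rule is_subfield_adjoin)
  note K = is_subfieldD[OF sub]
  have lamK: "lam \<in> K" using R_subset_K R_intros(5) by blast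
  have add: "\<phi> (x + y) = \<phi> x + \<phi> y" and mult: "\<phi> (x * y) = \<phi> x * \<phi> y" if xy: "x \<in> K" "y \<in> K" for x y
  proof -
    obtain D Q where D: "D \<noteq> 0" "poly_to_ac D * x = poly_at Q lam" using xy(1) by (rule K_E)
    obtain D' Q' where D': "D' \<noteq> 0" "poly_to_ac D' * y = poly_at Q' lam" using xy(2) by (rule K_E)
    have "poly_to_ac (D * D') * (x + y) =
        poly_to_ac D' * (poly_to_ac D * x) + poly_to_ac D * (poly_to_ac D' * y)"
      "poly_to_ac (D * D') * (x * y) = (poly_to_ac D * x) * (poly_to_ac D' * y)"
      by (simp_all add: algebra_simps)
    then have "poly_to_ac (D * D') * (x + y) = poly_at (smult D' Q + smult D Q') lam"
      "poly_to_ac (D * D') * (x * y) = poly_at (Q * Q') lam"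
      unfolding D(2) D'(2) by simp_all
    from this[THEN \<phi>[rotated]] K(4,5)[OF xy]
    have "poly_to_ac (D * D') * \<phi> (x + y) = poly_at (smult D' Q + smult D Q') (conj_lam n)"
      "poly_to_ac (D * D') * \<phi> (x * y) = poly_at (Q * Q') (conj_lam n)" by simp_all
    moreover have "poly_at (smult D' Q + smult D Q') (conj_lam n) =
        poly_to_ac D' * (poly_to_ac D * \<phi> x) + poly_to_ac D * (poly_to_ac D' * \<phi> y)"
      "poly_at (Q * Q') (conj_lam n) = (poly_to_ac D * \<phi> x) * (poly_to_ac D' * \<phi> y)"
      unfolding \<phi>[OF xy(1) D(2)] \<phi>[OF xy(2) D'(2)] by simp_all
    ultimately have "poly_to_ac (D * D') * \<phi> (x + y) = poly_to_ac (D * D') * (\<phi> x + \<phi> y)"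
      "poly_to_ac (D * D') * \<phi> (x * y) = poly_to_ac (D * D') * (\<phi> x * \<phi> y)"
      by (simp_all only:) (simp_all add: algebra_simps)
    moreover have "poly_to_ac (D * D') \<noteq> 0" using D(1) D'(1) by (simp del: emb.map_mult)
    ultimately show "\<phi> (x + y) = \<phi> x + \<phi> y" "\<phi> (x * y) = \<phi> x * \<phi> y" by (metis mult_left_cancel)+
  qed
  have base: "\<phi> x = x" if "x \<in> base_field" for x
  proof -
    obtain z where z: "x = to_ac z" using \<open>x \<in> base_field\<close> by (auto simp: base_field_def)
    obtain a b where b: "b \<noteq> 0" "poly_to_ac b * x = poly_to_ac a"
      unfolding z by (rule to_ac_eq_quotient)
    have "poly_to_ac b * x = poly_at [:a:] lam" using b(2) by simp
    moreover have "x \<in> K"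
      using that adjoin_superset[of lam base_field] by (auto simp: carlitz_field_def)
    ultimately have "poly_to_ac b * \<phi> x = poly_at [:a:] (conj_lam n)" by (rule \<phi>[rotated])
    then have "poly_to_ac b * \<phi> x = poly_to_ac b * x" using b(2) by simp
    then show ?thesis using b(1) by simp
  qed
  have \<phi>01: "\<phi> 0 = 0" "\<phi> 1 = 1" using base emb_in_base[of 0] emb_in_base[of 1] by auto
  have "inj_on \<phi> K"
  proof (rule inj_onI, rule ccontr)
    fix x y assume xy: "x \<in> K" "y \<in> K" "\<phi> x = \<phi> y" "x \<noteq> y"
    have d: "x - y \<in> K" using K(3) xy by blast
    have "\<phi> (x - y) = 0" using add[OF d xy(2)] xy(3) by simp
    moreover have "\<phi> ((x - y) * inverse (x - y)) = \<phi> (x - y) * \<phi> (inverse (x - y))"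
      using d K(6)[OF d] by (rule mult)
    ultimately show False using xy(4) \<phi>01 by simp
  qed
  moreover have "\<phi> ` K \<subseteq> K"
  proof
    fix y assume "y \<in> \<phi> ` K"
    then obtain x where x: "x \<in> K" "y = \<phi> x" by blast
    obtain D Q where D: "D \<noteq> 0" "poly_to_ac D * x = poly_at Q lam" using x(1) by (rule K_E)
    have "poly_to_ac D * y \<in> R"
      unfolding x(2) \<phi>[OF x(1) D(2)] by (rule poly_at_conj_lam_in_R)
    then show "y \<in> K" by (rule K_I[OF D(1)])
  qed
  moreover have "K \<subseteq> \<phi> ` K"
  proof
    fix y assume y: "y \<in> K"
    obtain D Q where D: "D \<noteq> 0" "poly_to_ac D * y = poly_at Q lam" using y by (rule K_E)
    obtain b where b: "carlitz_eval b (conj_lam n) = lam" by (rule ex_inverse_conj_lam)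
    \<comment> \<open>A preimage of \<open>y\<close>: C_b sends \<open>conj_lam n\<close> back to
      \<open>lam\<close>, so composing with it compensates \<phi>.\<close>
    define x where "x = poly_at (pcompose Q (carlitz_poly b)) lam / poly_to_ac D"
    have x: "poly_to_ac D * x = poly_at (pcompose Q (carlitz_poly b)) lam"
      using D(1) unfolding x_def by simp
    have xK: "x \<in> K" by (rule K_I[OF D(1)]) (unfold x, rule R_intros)
    have "poly_to_ac D * \<phi> x = poly_at (pcompose Q (carlitz_poly b)) (conj_lam n)"
      using xK x by (rule \<phi>)
    also have "\<dots> = poly_to_ac D * y" using D(2) b by (simp flip: carlitz_eval_eq)
    finally have "y = \<phi> x" using D(1) by simp
    then show "y \<in> \<phi> ` K" using xK by blast
  qed
  ultimately have bij: "bij_betw \<phi> K K" by (auto simp: bij_betw_def)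
  have base_K: "base_field \<subseteq> K"
    using adjoin_superset[of lam base_field] by (auto simp: carlitz_field_def)
  define \<tau> where "\<tau> = restrict \<phi> K"
  have \<tau>: "\<tau> x = \<phi> x" if "x \<in> K" for x using that by (simp add: \<tau>_def)
  have "\<tau> \<in> G"
    unfolding galois_group_def
  proof (intro CollectI conjI ballI)
    show "\<tau> \<in> extensional K" by (simp add: \<tau>_def)
    show "bij_betw \<tau> K K" using bij \<tau> by (simp cong: bij_betw_cong)
    show "\<tau> (x + y) = \<tau> x + \<tau> y" "\<tau> (x * y) = \<tau> x * \<tau> y" if "x \<in> K" "y \<in> K" for x y
      using that by (simp_all add: \<tau> K add mult)
    show "\<tau> x = x" if "x \<in> base_field" for x
      using that base_K base \<tau> by auto
  qed
  moreover have "poly_to_ac 1 * lam = poly_at [:0, 1:] lam" by simp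
  from \<phi>[OF lamK this] have "\<tau> lam = conj_lam n" using \<tau>[OF lamK] by simp
  ultimately show ?thesis by (rule that)
qed

text \<open>An automorphism is determined by its value at \<open>lam\<close>, a root of
  \<open>f\<close>, and every conjugate occurs as such a value.\<close>

lemma galois_norm_eq: "galois_norm K base_field (poly_at Q lam) = (\<Prod>n<N. poly_at Q (conj_lam n))"
proof -
  have bij: "bij_betw (\<lambda>\<tau>. \<tau> lam) G (conj_lam ` {..<N})"
    unfolding bij_betw_def
  proof (intro conjI equalityI subsetI)
    show "inj_on (\<lambda>\<tau>. \<tau> lam) G"
    proof (rule inj_onI)
      fix \<sigma> \<tau> assume st: "\<sigma> \<in> G" "\<tau> \<in> G" "\<sigma> lam = \<tau> lam"
      show "\<sigma> = \<tau>"
      proof (rule extensionalityI[of _ K])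
        show "\<sigma> \<in> extensional K" "\<tau> \<in> extensional K" using st by (auto simp: galois_group_def)
        fix x assume "x \<in> K"
        then obtain D Q where "D \<noteq> 0" "poly_to_ac D * x = poly_at Q lam" by (rule K_E)
        then show "\<sigma> x = \<tau> x" using st(3) by (simp add: galois_eq_quotient st)
      qed
    qed
  next
    fix x assume "x \<in> (\<lambda>\<tau>. \<tau> lam) ` G"
    then obtain \<tau> where \<tau>: "\<tau> \<in> G" "x = \<tau> lam" by blast
    have "poly_at f x = \<tau> (poly_at f lam)" using galois_poly_at[OF \<tau>(1)] \<tau>(2) by simp
    also have "\<dots> = \<tau> (poly_at 0 lam)" using poly_at_f_conj_lam[of 0] by simp
    also have "\<dots> = 0" unfolding galois_poly_at[OF \<tau>(1)] by simp
    finally show "x \<in> conj_lam ` {..<N}" by (simp add: image_conj_lam)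
  next
    fix x assume "x \<in> conj_lam ` {..<N}"
    then obtain n where "x = conj_lam n" by blast
    moreover obtain \<tau> where "\<tau> \<in> G" "\<tau> lam = conj_lam n" by (rule ex_galois_conj)
    ultimately show "x \<in> (\<lambda>\<tau>. \<tau> lam) ` G"
      by (intro image_eqI[of _ _ \<tau>]) simp_all
  qed
  have "galois_norm K base_field (poly_at Q lam) = (\<Prod>\<tau>\<in>G. poly_at Q (\<tau> lam))"
    unfolding galois_norm_def by (rule prod.cong) (simp_all add: galois_poly_at)
  also have "\<dots> = (\<Prod>x\<in>conj_lam ` {..<N}. poly_at Q x)"
    by (rule prod.reindex_bij_betw[OF bij])
  also have "\<dots> = (\<Prod>n<N. poly_at Q (conj_lam n))"
    by (simp add: prod.reindex inj_on_conj_lam)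
  finally show ?thesis .
qed

subsection \<open>Units of norm one\<close>

lemma unit_inverse_poly:
  assumes "poly_at U lam \<in> units_in R"
  obtains V where "\<And>n. poly_at U (conj_lam n) * poly_at V (conj_lam n) = 1"
proof -
  obtain V where V: "inverse (poly_at U lam) = poly_at V lam"
    using units_inD(2)[OF assms] by (rule R_E)
  have "poly_at (U * V) lam = poly_at 1 lam" using units_inD(3)[OF assms] by (simp flip: V)
  from poly_at_eq_imp_conj[OF this] show ?thesis by (intro that) simp
qed

lemma unit_conj:
  assumes "poly_at U lam \<in> units_in R"
  shows "poly_at U (conj_lam n) \<in> units_in R"
proof -
  obtain V where V: "\<And>n. poly_at U (conj_lam n) * poly_at V (conj_lam n) = 1"
    using unit_inverse_poly[OF assms] by blast
  show ?thesis
    unfolding units_in_def using V[of n] by (auto intro!: bexI[of _ "poly_at V (conj_lam n)"])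
qed

text \<open>If all sums vanished, linearity would allow any polynomial in place of the powers; one
  vanishing at every conjugate except \<open>lam\<close> isolates \<open>b 0\<close>.\<close>

lemma ex_nonzero_power_sum:
  assumes "b 0 \<noteq> 0"
  shows "\<exists>m. (\<Sum>i<N. b i * conj_lam i ^ m) \<noteq> 0"
proof (rule ccontr)
  assume "\<not> ?thesis"
  then have 0: "(\<Sum>i<N. b i * conj_lam i ^ m) = 0" for m by simp
  define p where "p = (\<Prod>j\<in>{..<N} - {0}. [:- conj_lam j, 1:])"
  have "(\<Sum>i<N. b i * poly p (conj_lam i)) =
      (\<Sum>i<N. \<Sum>m\<le>degree p. coeff p m * (b i * conj_lam i ^ m))"
    by (simp add: poly_altdef sum_distrib_left mult_ac)
  also have "\<dots> = (\<Sum>m\<le>degree p. coeff p m * (\<Sum>i<N. b i * conj_lam i ^ m))"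
    by (subst sum.swap) (simp add: sum_distrib_left)
  finally have "(\<Sum>i<N. b i * poly p (conj_lam i)) = 0" by (simp add: 0)
  moreover have "poly p (conj_lam i) = 0" if "i \<in> {..<N} - {0}" for i
    unfolding p_def poly_prod using that by (intro prod_zero) auto
  then have "(\<Sum>i<N. b i * poly p (conj_lam i)) = b 0 * poly p (conj_lam 0)"
    using N_pos by (subst sum.remove[of _ 0]) auto
  ultimately have "poly p (conj_lam 0) = 0" using assms by simp
  then have "\<exists>j\<in>{..<N} - {0}. conj_lam 0 = conj_lam j"
    unfolding p_def poly_prod by (subst (asm) prod_zero_iff) (simp_all del: conj_lam_0)
  then obtain j where "j \<in> {..<N} - {0}" "conj_lam 0 = conj_lam j" by (rule bexE)
  then show False using inj_onD[OF inj_on_conj_lam, of 0 j] N_pos by auto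
qed

lemma hilbert90:
  assumes "(\<Prod>n<N. poly_at E (conj_lam n)) = 1"
  obtains Q where "poly_at Q lam \<noteq> 0" "poly_at Q lam = poly_at E lam * poly_at Q (conj_lam 1)"
proof -
  define b where "b i = (\<Prod>j<i. poly_at E (conj_lam j))" for i
  have b0: "b 0 = 1" and bN: "b N = 1" using assms by (simp_all add: b_def)
  obtain m where m: "(\<Sum>i<N. b i * conj_lam i ^ m) \<noteq> 0"
    using ex_nonzero_power_sum[of b] b0 by auto
  \<comment> \<open>The Hilbert 90 resolvent, the sum of b_i \<sigma>^i(lam^m), lifted to A[x];
    \<open>m\<close> makes its value at \<open>lam\<close> nonzero.\<close>
  define Q where "Q = (\<Sum>i<N. (\<Prod>j<i. shift j E) * carlitz_poly (g ^ i) ^ m)"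
  have Q: "poly_at Q (conj_lam k) =
      (\<Sum>i<N. (\<Prod>j<i. poly_at E (conj_lam (j + k))) * conj_lam (i + k) ^ m)" for k
  proof -
    interpret ev: comm_ring_map "\<lambda>S. poly_at S (conj_lam k)"
      by (rule emb.comm_ring_map_poly)
    show ?thesis
      unfolding Q_def by (simp add: ev.map_sum ev.map_prod poly_at_shift conj_lam_add carlitz_eval_eq
        del: emb.map_poly_map_mult)
  qed
  have "poly_at E lam * poly_at Q (conj_lam 1) = (\<Sum>i<N. b (Suc i) * conj_lam (Suc i) ^ m)"
    unfolding Q b_def prod.lessThan_Suc_shift by (simp add: sum_distrib_left mult.assoc)
  \<comment> \<open>Applying \<sigma> and multiplying by \<open>E(lam)\<close> has raised every
    index by one. The new last term equals the lost first one, as \<open>b N = b 0\<close> by the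
    norm condition.\<close>
  also have "\<dots> = (\<Sum>i<Suc N. b i * conj_lam i ^ m) - b 0 * conj_lam 0 ^ m"
    by (subst sum.lessThan_Suc_shift) simp
  also have "\<dots> = (\<Sum>i<N. b i * conj_lam i ^ m)" by (simp add: b0 bN)
  also have "\<dots> = poly_at Q lam" using Q[of 0] by (simp add: b_def)
  finally show ?thesis using m Q[of 0] by (intro that[of Q]) (simp_all add: b_def)
qed

text \<open>
  If \<open>x\<close> is associated to its conjugates, then its norm is \<open>x\<^sup>N\<close> times a unit, so every prime
  divisor of the norm gives a factor of \<open>x\<close>.
\<close>

lemma associated_conj_factorization:
  assumes "poly_to_ac c = (\<Prod>n<N. poly_at Q (conj_lam n))" "poly_at Q lam \<noteq> 0"
    and "poly_at Q lam / poly_at Q (conj_lam 1) \<in> units_in R"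
  shows "\<exists>m a \<eta>. a \<noteq> 0 \<and> \<eta> \<in> units_in R \<and> poly_at Q lam = lam ^ m * poly_to_ac a * \<eta>"
  using assms
proof (induction "degree c" arbitrary: c Q rule: less_induct)
  case (less c Q)
  define x where "x = poly_at Q lam"
  have xR: "x \<in> R" and x0: "x \<noteq> 0" using less.prems(2) by (auto simp: x_def)
  have nz: "poly_at Q (conj_lam n) \<noteq> 0" for n
    using less.prems(2) by (simp add: poly_at_conj_lam_eq_0_iff)
  then have "poly_to_ac c \<noteq> 0" unfolding less.prems(1) by simp
  then have c0: "c \<noteq> 0" by simp
  obtain U where U: "poly_at Q lam / poly_at Q (conj_lam 1) = poly_at U lam"
    using units_inD(1)[OF less.prems(3)] by (rule R_E)
  have U_unit: "poly_at U (conj_lam n) \<in> units_in R" for n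
    using unit_conj less.prems(3) unfolding U by blast
  have "poly_at Q lam = poly_at U lam * poly_at Q (conj_lam 1)"
    using nz[of 1] by (simp flip: U)
  then have "poly_at Q lam = poly_at (U * shift 1 Q) lam"
    using poly_at_shift[of 1 Q 0] by simp
  note conj_eq = poly_at_eq_imp_conj[OF this]
  have step: "poly_at Q (conj_lam n) = poly_at U (conj_lam n) * poly_at Q (conj_lam (Suc n))" for n
    using conj_eq[of n] poly_at_shift[of 1 Q n] by simp
  have ratio: "poly_at Q (conj_lam n) / x \<in> units_in R" for n
  proof (induction n)
    case 0
    then show ?case using x0 units_R_1 by (simp add: x_def)
  next
    case (Suc n)
    have "poly_at Q (conj_lam (Suc n)) / x = poly_at Q (conj_lam n) / x / poly_at U (conj_lam n)"
      using step[of n] nz[of n] x0 by (simp add: field_simps)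
    then show ?case using units_R_divide[OF Suc U_unit] by (simp only:)
  qed
  define v where "v = (\<Prod>n<N. poly_at Q (conj_lam n) / x)"
  have v: "v \<in> units_in R" unfolding v_def using ratio by (rule units_R_prod)
  have cv: "poly_to_ac c = x ^ N * v"
    unfolding v_def less.prems(1) prod_dividef using x0 by simp
  show ?case
  proof (cases "degree c = 0")
    case True
    then have "is_unit c" using c0 by (simp add: is_unit_iff_degree)
    then obtain d where "1 = c * d" by (rule dvdE)
    then have "poly_to_ac c * poly_to_ac d = 1" by (metis emb.map_mult emb.map_one)
    then have "poly_to_ac c \<in> units_in R" by (auto simp: units_in_def)
    moreover have "poly_to_ac c = x * (x ^ (N - 1) * v)"
      using N_pos unfolding cv by (simp add: power_eq_if)
    moreover have "x ^ (N - 1) * v \<in> R" using xR units_inD(1)[OF v] by (intro R_intros)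
    ultimately have "x \<in> units_in R" using units_R_factor[OF xR] by simp
    then show ?thesis
      by (intro exI[of _ 0] exI[of _ 1] exI[of _ x]) (simp add: x_def)
  next
    case False
    then have "degree c > 0" by simp
    then obtain \<theta> :: "'a alg_closure" and r where r: "irreducible r" "degree r > 0" "r dvd c"
      "\<And>a. poly (map_poly to_ac a) \<theta> = 0 \<longleftrightarrow> r dvd a"
      by (rule ex_residue_root) (rule that)
    have power: "\<exists>y\<in>R. x ^ N = poly_to_ac s * y" if "s dvd c" for s
    proof -
      obtain c' where c': "c = s * c'" using \<open>s dvd c\<close> by (rule dvdE)
      have "x ^ N = poly_to_ac s * (poly_to_ac c' * inverse v)"
        using cv units_inD(3)[OF v] unfolding c' by (simp add: field_simps)
      moreover have "poly_to_ac c' * inverse v \<in> R"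
        using units_inD(2)[OF v] by (intro R_intros)
      ultimately show ?thesis by blast
    qed
    \<comment> \<open>A factor \<open>S\<close> of \<open>x\<close> is split off, either
      \<open>- lam\<close> or the prime \<open>r\<close>. Its norm \<open>s\<close> is nonconstant,
      so the norm of the cofactor \<open>Z\<close> has smaller degree.\<close>
    have "\<exists>S s Z i b. poly_at Q lam = poly_at (S * Z) lam \<and>
        poly_to_ac s = (\<Prod>n<N. poly_at S (conj_lam n)) \<and> degree s > 0 \<and>
        poly_at S lam / poly_at S (conj_lam 1) \<in> units_in R \<and>
        b \<noteq> 0 \<and> poly_at S lam = lam ^ i * poly_to_ac b"
    proof (cases "r dvd P")
      case True
      then have "P dvd c"
        using irreducible_dvd_irreducible[OF r(1) irreducible_P] r(3) dvd_trans by blast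
      then obtain y where y: "y \<in> R" "x ^ N = poly_to_ac P * y" using power by blast
      have "lam ^ N = lam * lam ^ (N - 1)" using N_pos by (simp add: power_eq_if)
      then have "x ^ N = lam * (lam ^ (N - 1) * (poly_to_ac P / lam ^ N) * y)"
        unfolding y(2) by (simp add: field_simps)
      moreover have "lam ^ (N - 1) * (poly_to_ac P / lam ^ N) * y \<in> R"
        using units_inD(1)[OF P_div_unit] y(1) by (simp only: R_intros)
      ultimately obtain z where z: "z \<in> R" "x = lam * z" using lam_dvd_power[OF xR] by blast
      obtain Z where Z: "z = poly_at Z lam" using z(1) by (rule R_E)
      \<comment> \<open>The sign is chosen so that the norm of the factor is exactly
        \<open>P\<close>.\<close>
      have "poly_at [:0, - 1:] lam / poly_at [:0, - 1:] (conj_lam 1) = inverse (conj_lam 1 / lam)"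
        by simp
      moreover have "inverse (conj_lam 1 / lam) \<in> units_in R"
        by (intro units_R_inverse conj_lam_div_unit)
      ultimately show ?thesis
        using z(2) degree_P
        by (intro exI[of _ "[:0, - 1:]"] exI[of _ P] exI[of _ "- Z"] exI[of _ "1::nat"] exI[of _ "- 1"])
           (simp add: x_def Z P_eq_prod)
    next
      case False
      obtain y where y: "y \<in> R" "x ^ N = poly_to_ac r * y" using power r(3) by blast
      obtain z where z: "z \<in> R" "x = poly_to_ac r * z"
        using unramified_dvd_power[OF r(1) False xR y] by blast
      obtain Z where Z: "z = poly_at Z lam" using z(1) by (rule R_E)
      have r0: "r \<noteq> 0" using r(2) by auto
      have "degree (r ^ N) > 0" using r(2) r0 N_pos by (simp add: degree_power_eq)
      then show ?thesis
        using z(2) r0 units_R_1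
        by (intro exI[of _ "[:r:]"] exI[of _ "r ^ N"] exI[of _ Z] exI[of _ "0::nat"] exI[of _ r])
           (simp add: x_def Z)
    qed
    then obtain S s Z i b where S: "poly_at Q lam = poly_at (S * Z) lam"
      "poly_to_ac s = (\<Prod>n<N. poly_at S (conj_lam n))" "degree s > 0"
      "poly_at S lam / poly_at S (conj_lam 1) \<in> units_in R" "b \<noteq> 0"
      "poly_at S lam = lam ^ i * poly_to_ac b" by blast
    have SZ: "poly_at Q (conj_lam n) = poly_at S (conj_lam n) * poly_at Z (conj_lam n)" for n
      using poly_at_eq_imp_conj[OF S(1), of n] by simp
    obtain c' where c': "poly_to_ac c' = (\<Prod>n<N. poly_at Z (conj_lam n))" by (rule norm_exists)
    have "poly_to_ac c = poly_to_ac (s * c')"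
      by (simp add: less.prems(1) S(2) c' SZ prod.distrib)
    then have "c = s * c'" by (simp only: poly_to_ac_eq_iff)
    then have smaller: "degree c' < degree c" using c0 S(3) by (auto simp: degree_mult_eq)
    have Z0: "poly_at Z lam \<noteq> 0" using S(1) less.prems(2) by auto
    have "poly_at Z lam / poly_at Z (conj_lam 1) =
        (poly_at Q lam / poly_at Q (conj_lam 1)) / (poly_at S lam / poly_at S (conj_lam 1))"
      using SZ[of 0] SZ[of 1] nz[of 0] nz[of 1] by (simp add: field_simps)
    also have "\<dots> \<in> units_in R" using less.prems(3) S(4) by (rule units_R_divide)
    finally obtain m a \<eta> where *: "a \<noteq> 0" "\<eta> \<in> units_in R" "poly_at Z lam = lam ^ m * poly_to_ac a * \<eta>"
      using less.hyps[OF smaller c' Z0] by blast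
    have "poly_at Q lam = lam ^ (i + m) * poly_to_ac (b * a) * \<eta>"
      using S(1) by (simp add: S(6) *(3) power_add)
    then show ?thesis using *(1,2) S(5) by (intro exI[of _ "i + m"] exI[of _ "b * a"] exI[of _ \<eta>]) simp
  qed
qed

section \<open>Existence and uniqueness of the representation\<close>

lemma reduce_lam_exponent:
  assumes "\<eta> \<in> units_in R" "a \<noteq> 0"
  obtains l b \<eta>' where "l < N" "b \<noteq> 0" "\<eta>' \<in> units_in R"
    "lam ^ m * poly_to_ac a * \<eta> = lam ^ l * poly_to_ac b * \<eta>'"
proof -
  define u where "u = inverse (poly_to_ac P / lam ^ N)"
  have u: "u \<in> units_in R" unfolding u_def by (intro units_R_inverse P_div_unit)
  \<comment> \<open>As \<open>lam^N\<close> is \<open>P\<close> times a unit, full multiples of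
    \<open>N\<close> in the exponent move into the factor from A.\<close>
  have N: "lam ^ N = poly_to_ac P * u" by (simp add: u_def)
  have "lam ^ m = lam ^ (N * (m div N) + m mod N)" by simp
  also have "\<dots> = (poly_to_ac P * u) ^ (m div N) * lam ^ (m mod N)"
    unfolding power_add power_mult N ..
  finally have eq: "lam ^ m * poly_to_ac a * \<eta> =
      lam ^ (m mod N) * poly_to_ac (P ^ (m div N) * a) * (u ^ (m div N) * \<eta>)"
    by (simp add: power_mult_distrib mult_ac)
  have "u ^ (m div N) * \<eta> \<in> units_in R" using u assms(1) by (intro units_R_mult units_R_power)
  then show ?thesis using assms(2) N_pos by (intro that[OF _ _ _ eq]) simp_all
qed

text \<open>In the quotient from Hilbert 90 the factor from A is fixed by \<sigma>_g and cancels,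
  leaving a power of \<open>lam\<close> and a unit.\<close>

lemma ex_representation:
  assumes "\<epsilon> \<in> units_in R" "galois_norm K base_field \<epsilon> = 1"
  obtains l H where "l < N" "degree H < N" "poly_at H lam \<in> units_in R"
    "\<epsilon> = (lam / conj_lam 1) ^ l * (poly_at H lam / poly_at H (conj_lam 1))"
proof -
  obtain E where E: "\<epsilon> = poly_at E lam" using units_inD(1)[OF assms(1)] by (rule R_E)
  then have "(\<Prod>n<N. poly_at E (conj_lam n)) = 1" using assms(2) galois_norm_eq[of E] by simp
  then obtain Q where Q: "poly_at Q lam \<noteq> 0" "poly_at Q lam = \<epsilon> * poly_at Q (conj_lam 1)"
    unfolding E by (rule hilbert90)
  then have nz: "poly_at Q (conj_lam 1) \<noteq> 0" by (simp only: poly_at_conj_lam_eq_0_iff not_False_eq_True)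
  have eps: "\<epsilon> = poly_at Q lam / poly_at Q (conj_lam 1)" using Q(2) nz by (simp add: field_simps)
  obtain c where "poly_to_ac c = (\<Prod>n<N. poly_at Q (conj_lam n))" by (rule norm_exists)
  then obtain m a \<eta> where "a \<noteq> 0" "\<eta> \<in> units_in R" "poly_at Q lam = lam ^ m * poly_to_ac a * \<eta>"
    using associated_conj_factorization[of c Q] Q(1) assms(1) eps by auto
  then obtain l b \<eta>' where l: "l < N" "b \<noteq> 0" "\<eta>' \<in> units_in R"
    "poly_at Q lam = lam ^ l * poly_to_ac b * \<eta>'"
    using reduce_lam_exponent[of \<eta> a m] by auto
  obtain H where H: "\<eta>' = poly_at H lam" "degree H < N"
    using units_inD(1)[OF l(3)] by (rule R_E_reduced)
  have "poly_at Q lam = poly_at ([:0, 1:] ^ l * [:b:] * H) lam"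
    using l(4) by (simp add: H(1))
  from poly_at_eq_imp_conj[OF this, of 1]
  have "poly_at Q (conj_lam 1) = conj_lam 1 ^ l * poly_to_ac b * poly_at H (conj_lam 1)" by simp
  then have "\<epsilon> = (lam / conj_lam 1) ^ l * (poly_at H lam / poly_at H (conj_lam 1))"
    using l(2) unfolding eps l(4) H(1) by (simp add: power_divide)
  then show ?thesis using l(1,3) H by (intro that) simp_all
qed

text \<open>The ratio of the two representations yields an element \<open>lam^k w\<close> fixed by
  \<sigma>_g, hence in A, with \<open>w\<close> a unit and \<open>k < N\<close>. Total ramification
  forces \<open>k = 0\<close>, and the units of A are the nonzero constants.\<close>

lemma representation_unique:
  assumes "l' \<le> l" "l < N" "degree H < N" "degree H' < N"
    and H: "poly_at H lam \<in> units_in R" and H': "poly_at H' lam \<in> units_in R"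
    and eq: "(lam / conj_lam 1) ^ l * (poly_at H lam / poly_at H (conj_lam 1)) =
      (lam / conj_lam 1) ^ l' * (poly_at H' lam / poly_at H' (conj_lam 1))"
  shows "l = l'" "\<exists>u. u \<noteq> 0 \<and> H = smult [:u:] H'"
proof -
  define k where "k = l - l'"
  have l: "l = l' + k" using assms(1) by (simp add: k_def)
  obtain V where V: "\<And>n. poly_at H' (conj_lam n) * poly_at V (conj_lam n) = 1"
    using unit_inverse_poly[OF H'] by blast
  have nz: "poly_at H lam \<noteq> 0" "poly_at H (conj_lam 1) \<noteq> 0" "poly_at H' lam \<noteq> 0"
    "poly_at H' (conj_lam 1) \<noteq> 0"
    using units_inD(3)[OF H] units_inD(3)[OF H'] units_inD(3)[OF unit_conj[OF H]]
      units_inD(3)[OF unit_conj[OF H']] by blast+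
  have V': "poly_at V lam = inverse (poly_at H' lam)"
    "poly_at V (conj_lam 1) = inverse (poly_at H' (conj_lam 1))"
    using V[of 0] V[of 1] by (simp_all add: inverse_unique)
  define F where "F = [:0, 1:] ^ k * H * V"
  have "(lam / conj_lam 1) ^ l' \<noteq> 0" by simp
  with eq have "(lam / conj_lam 1) ^ k * (poly_at H lam / poly_at H (conj_lam 1)) =
      poly_at H' lam / poly_at H' (conj_lam 1)"
    unfolding l power_add mult.assoc by (metis mult_left_cancel)
  then have "poly_at F (conj_lam 1) = poly_at F lam"
    using nz by (simp add: F_def V' field_simps del: One_nat_def)
  then obtain a where a: "poly_at F lam = poly_to_ac a" using fixed_in_base by blast
  define w where "w = poly_at H lam / poly_at H' lam"
  have w: "w \<in> units_in R" unfolding w_def using H H' by (rule units_R_divide)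
  have aw: "poly_to_ac a = lam ^ k * w"
    by (simp add: F_def V' w_def divide_inverse flip: a)
  have "k = 0"
  proof (rule ccontr)
    assume "k \<noteq> 0"
    then have "lam ^ k = lam * lam ^ (k - 1)" by (simp add: power_eq_if)
    then have "poly_at [:a:] lam = lam * (lam ^ (k - 1) * w)" using aw by (simp add: mult.assoc)
    moreover have "lam ^ (k - 1) * w \<in> R" using units_inD(1)[OF w] by (intro R_intros)
    ultimately have "P dvd coeff [:a:] 0" using lam_dvd_iff by blast
    then obtain b where b: "a = P * b" by (auto elim: dvdE)
    \<comment> \<open>The exponent left when \<open>lam^(k+1)\<close> is taken out of
      \<open>lam^N\<close>; since \<open>P\<close> divides \<open>a\<close>, one factor
      \<open>lam\<close> remains and would divide the unit \<open>w\<close>.\<close>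
    define t where "t = N - k - 1"
    have t: "N = Suc t + k" using \<open>k \<noteq> 0\<close> assms(2) by (auto simp: t_def k_def)
    have "lam ^ k * w = lam ^ N * (poly_to_ac P / lam ^ N) * poly_to_ac b"
      by (simp add: b flip: aw)
    also have "\<dots> = lam ^ k * (lam * (lam ^ t * (poly_to_ac P / lam ^ N) * poly_to_ac b))"
      by (subst (1) t) (simp only: power_add power_Suc mult_ac)
    finally have "w = lam * (lam ^ t * (poly_to_ac P / lam ^ N) * poly_to_ac b)"
      by (rule mult_left_cancel[THEN iffD1, rotated]) simp
    moreover have "lam ^ t * (poly_to_ac P / lam ^ N) * poly_to_ac b \<in> R"
      using units_inD(1)[OF P_div_unit] by (simp only: R_intros)
    ultimately have "lam \<in> units_in R" using units_R_factor[OF R_intros(5)] w by metis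
    then show False using lam_not_unit by blast
  qed
  then show "l = l'" using l by simp
  have "poly_to_ac a \<in> units_in R" using aw w \<open>k = 0\<close> by simp
  then have a_inv: "inverse (poly_to_ac a) \<in> R" "poly_to_ac a \<noteq> 0" by (rule units_inD)+
  \<comment> \<open>The inverse of \<open>a\<close> is so far only known to lie in \<open>R\<close>.
    With a reduced representative, \<open>a Y = 1\<close> holds in A[x], and constant terms show
    that \<open>a\<close> is a unit of A.\<close>
  obtain Y where Y: "inverse (poly_to_ac a) = poly_at Y lam" "degree Y < N"
    using a_inv(1) by (rule R_E_reduced)
  have "poly_at (smult a Y) lam = poly_at 1 lam" using a_inv(2) by (simp flip: Y(1))
  then have "smult a Y = 1"
    using Y(2) N_pos by (intro poly_at_lam_inj le_less_trans[OF degree_smult_le]) simp_all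
  from arg_cong[OF this, of "\<lambda>p. coeff p 0"] have "a * coeff Y 0 = 1" by simp
  then have "is_unit a" by (metis dvd_triv_left)
  then obtain u where u: "a = [:u:]" by (auto simp: is_unit_poly_iff)
  with a_inv(2) have "u \<noteq> 0" by auto
  have "poly_at H lam = poly_at (smult a H') lam"
    using aw \<open>k = 0\<close> nz(3) by (simp add: w_def)
  then have "H = smult a H'"
    using assms(3,4) by (intro poly_at_lam_inj le_less_trans[OF degree_smult_le])
  then show "\<exists>u. u \<noteq> 0 \<and> H = smult [:u:] H'" using u \<open>u \<noteq> 0\<close> by blast
qed

end

section \<open>Transfer from \<open>R\<close> and \<open>conj_lam\<close> to the integral closure
  and C_g(lam)\<close>

theorem theorem3p7:
  fixes P g :: "'a::{finite,field} poly"
    and lam eps :: "'a poly fract alg_closure"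
  assumes "lead_coeff P = 1" and "irreducible P" and "degree P > 0"
    and "CARD('a) > 2 \<or> degree P > 1"
    and "is_carlitz_generator P lam"
    and "generates_units_mod P g"
    and "eps \<in> units_in (carlitz_integers lam)"
    and "galois_norm (carlitz_field lam) base_field eps = 1"
  shows "\<exists>(l::nat) (Q :: 'a poly poly).
      l \<le> CARD('a) ^ degree P - 2 \<and>
      degree Q \<le> CARD('a) ^ degree P - 2 \<and>
      poly_at Q lam \<in> units_in (carlitz_integers lam) \<and>
      eps = (lam / carlitz_eval g lam) ^ l * (poly_at Q lam / poly_at Q (carlitz_eval g lam)) \<and>
      (\<forall>(l'::nat) (Q' :: 'a poly poly).
         l' \<le> CARD('a) ^ degree P - 2 \<and>
         degree Q' \<le> CARD('a) ^ degree P - 2 \<and>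
         poly_at Q' lam \<in> units_in (carlitz_integers lam) \<and>
         eps = (lam / carlitz_eval g lam) ^ l' * (poly_at Q' lam / poly_at Q' (carlitz_eval g lam))
         \<longrightarrow> l' = l \<and> (\<exists>u::'a. u \<noteq> 0 \<and> Q' = smult [:u:] Q))"
proof -
  interpret carlitz_prime P g lam
    using assms by unfold_locales
  \<comment> \<open>By \<open>Suc_N\<close> the bound is \<open>N - 1\<close>, and
    \<open>N > 0\<close> makes this equivalent to a strict bound by \<open>N\<close>.\<close>
  have bound: "n \<le> CARD('a) ^ degree P - 2 \<longleftrightarrow> n < N" for n
    using N_pos by (auto simp flip: Suc_N)
  obtain l Q where lQ: "l < N" "degree Q < N" "poly_at Q lam \<in> units_in R"
    "eps = (lam / conj_lam 1) ^ l * (poly_at Q lam / poly_at Q (conj_lam 1))"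
    using assms(7,8) unfolding carlitz_integers_eq by (rule ex_representation)
  have uniq: "l' = l \<and> (\<exists>u. u \<noteq> 0 \<and> Q' = smult [:u:] Q)"
    if "l' < N" "degree Q' < N" "poly_at Q' lam \<in> units_in R"
      "eps = (lam / conj_lam 1) ^ l' * (poly_at Q' lam / poly_at Q' (conj_lam 1))" for l' Q'
  proof -
    have eq: "(lam / conj_lam 1) ^ l * (poly_at Q lam / poly_at Q (conj_lam 1)) =
        (lam / conj_lam 1) ^ l' * (poly_at Q' lam / poly_at Q' (conj_lam 1))"
      by (simp only: lQ(4)[symmetric] that(4)[symmetric])
    \<comment> \<open>Uniqueness is available for ordered exponents, so the two representations are
      compared in whichever order applies.\<close>
    have "l' = l"
    proof (cases "l' \<le> l")
      case True
      show ?thesis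
        using representation_unique(1)[OF True lQ(1,2) that(2) lQ(3) that(3) eq] by simp
    next
      case False
      then have "l \<le> l'" by simp
      then show ?thesis
        using representation_unique(1)[OF _ that(1,2) lQ(2) that(3) lQ(3) eq[symmetric]] by simp
    qed
    then show ?thesis
      using representation_unique(2)[OF _ that(1,2) lQ(2) that(3) lQ(3) eq[symmetric]] by simp
  qed
  show ?thesis
    unfolding carlitz_integers_eq bound conj_lam_1[symmetric]
    using lQ uniq by blast
qed

end
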